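(* Let $G_1$ be the simply connected solvable Lie group of dimension $7$ whose Lie algebra is defined, in terms of a basis $e^1,\dots,e^7$ of left invariant $1$-forms, by $$\begin{aligned} de^1&=0,\\ de^2&=\tfrac12e^{15}-e^{34}+\tfrac12e^{46},\\ de^3&=\tfrac12e^{16}+e^{24}-\tfrac12e^{45},\\ de^4&=-2e^{14},\\ de^5&=2(e^{12}+e^{34})-e^{46},\\ de^6&=2(e^{13}+e^{42})+e^{45},\\ de^7&=2(e^{14}+e^{23})-\tfrac12e^{56}, \end{aligned}$$ and let $e_1,\dots,e_7$ be the dual basis of left invariant vector fields. The left invariant integrable qc structure on $G_1$ given by $\eta_1=e^5$, $\eta_2=e^6$, $\eta_3=e^7$, $H=\mathrm{Span}\{e_1,\dots,e_4\}$ (with $e_1,\dots,e_4$ orthonormal), $\omega_1=e^{12}+e^{34}$, $\omega_2=e^{13}+e^{42}$, $\omega_3=e^{14}+e^{23}$, is not locally qc conformally flat.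
   Context: Notation: $e^{ij}=e^i\wedge e^j$. A quaternionic contact (qc) structure on a $7$-manifold $M$ consists of a rank $4$ distribution $H$ with a metric $g$, locally the common kernel of $1$-forms $\eta_1,\eta_2,\eta_3$, and $g$-Hermitian almost complex structures $I_1,I_2,I_3$ on $H$ satisfying the quaternion identities $I_1I_2=-I_2I_1=I_3$, with $2g(I_rX,Y)=d\eta_r(X,Y)$ for $X,Y\in H$; $\omega_r(X,Y)=g(I_rX,Y)$. For a given $H$ the triplet $(\eta_1,\eta_2,\eta_3)$ is determined up to a conformal factor and the action of $SO(3)$. The standard flat qc structure on the $7$-dimensional quaternionic Heisenberg group $G(\mathbb{H})=\mathbb{H}\times\mathrm{Im}(\mathbb{H})$ is the left invariant one with coframe $\theta^1,\dots,\theta^7$ satisfying $d\theta^1=\dots=d\theta^4=0$, $d\theta^5=2(\theta^{12}+\theta^{34})$, $d\theta^6=2(\theta^{13}+\theta^{42})$, $d\theta^7=2(\theta^{14}+\theta^{23})$, $\eta_r=\theta^{4+r}$, and the horizontal metric $\sum_{i=1}^4\theta^i\otimes\theta^i$. A qc structure on $M$ is locally qc conformally flat if it is locally qc conformal to the standard flat qc structure on $G(\mathbb{H})$: each point of $M$ has a neighbourhood $U$ and a diffeomorphism $F$ of $U$ onto an open subset of $G(\mathbb{H})$ with $F^*(\theta^5,\theta^6,\theta^7)^{t}=\nu\,\Psi\,(\eta_1,\eta_2,\eta_3)^{t}$ for a positive smooth function $\nu$ and a smooth $SO(3)$-valued function $\Psi$ on $U$. *)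

theory Defs
  imports "HOL-Analysis.Analysis" "HOL-Algebra.Solvable_Groups"
begin

section \<open>Smooth maps, atlases, Lie groups\<close>

text \<open>The set \<open>S\<close> is open in all uses of the following two notions.\<close>

primrec times_differentiable_on ::
    "nat \<Rightarrow> 'a::euclidean_space set \<Rightarrow> ('a \<Rightarrow> 'b::real_normed_vector) \<Rightarrow> bool" where
  "times_differentiable_on 0 S f \<longleftrightarrow> continuous_on S f"
| "times_differentiable_on (Suc k) S f \<longleftrightarrow>
     (\<forall>x\<in>S. f differentiable (at x)) \<and>
     (\<forall>v. times_differentiable_on k S (\<lambda>x. frechet_derivative f (at x) v))"

definition smooth_on :: "'a::euclidean_space set \<Rightarrow> ('a \<Rightarrow> 'b::real_normed_vector) \<Rightarrow> bool" where
  "smooth_on S f \<longleftrightarrow> (\<forall>k. times_differentiable_on k S f)"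

text \<open>A chart is its domain together with a coordinate map (whose values outside the domain are
  irrelevant). A manifold is the whole of a Hausdorff, second countable type with an atlas.\<close>

type_synonym ('m, 'e) chart = "'m set \<times> ('m \<Rightarrow> 'e)"

abbreviation chart_dom :: "('m, 'e) chart \<Rightarrow> 'm set" where "chart_dom \<equiv> fst"
abbreviation coord :: "('m, 'e) chart \<Rightarrow> 'm \<Rightarrow> 'e" where "coord \<equiv> snd"

definition chart_range :: "('m, 'e) chart \<Rightarrow> 'e set" where
  "chart_range c = coord c ` chart_dom c"

definition chart_inv :: "('m, 'e) chart \<Rightarrow> 'e \<Rightarrow> 'm" where
  "chart_inv c = inv_into (chart_dom c) (coord c)"

definition smooth_atlas ::
    "('m::{t2_space,second_countable_topology}, 'e::euclidean_space) chart set \<Rightarrow> bool" where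
  "smooth_atlas A \<longleftrightarrow>
     (\<Union>c\<in>A. chart_dom c) = UNIV \<and>
     (\<forall>c\<in>A. open (chart_dom c) \<and> open (chart_range c) \<and>
        homeomorphism (chart_dom c) (chart_range c) (coord c) (chart_inv c)) \<and>
     (\<forall>c\<in>A. \<forall>d\<in>A. smooth_on (coord c ` (chart_dom c \<inter> chart_dom d))
        (\<lambda>y. coord d (chart_inv c y)))"

definition euclidean_atlas :: "('e, 'e) chart set" where
  "euclidean_atlas = {(UNIV, id)}"

definition product_atlas ::
    "('m, 'e) chart set \<Rightarrow> ('n, 'f) chart set \<Rightarrow> ('m \<times> 'n, 'e \<times> 'f) chart set" where
  "product_atlas A B =
     {(chart_dom c \<times> chart_dom d, map_prod (coord c) (coord d)) | c d. c \<in> A \<and> d \<in> B}"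

definition smooth_map ::
    "('m::topological_space, 'e::euclidean_space) chart set \<Rightarrow>
     ('n::topological_space, 'f::euclidean_space) chart set \<Rightarrow> 'm set \<Rightarrow> ('m \<Rightarrow> 'n) \<Rightarrow> bool" where
  "smooth_map A B S f \<longleftrightarrow> continuous_on S f \<and>
     (\<forall>c\<in>A. \<forall>d\<in>B. smooth_on (coord c ` {x \<in> S \<inter> chart_dom c. f x \<in> chart_dom d})
        (\<lambda>y. coord d (f (chart_inv c y))))"

definition lie_group ::
    "('m::{t2_space,second_countable_topology}, 'e::euclidean_space) chart set \<Rightarrow> 'm monoid \<Rightarrow> bool" where
  "lie_group A G \<longleftrightarrow> smooth_atlas A \<and> group G \<and> carrier G = UNIV \<and>
     smooth_map (product_atlas A A) A UNIV (\<lambda>(a, b). a \<otimes>\<^bsub>G\<^esub> b) \<and>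
     smooth_map A A UNIV (\<lambda>a. inv\<^bsub>G\<^esub> a)"

section \<open>Tensor fields\<close>

text \<open>A tensor field on a manifold is given by its local representatives: \<open>T c y\<close> is the value, in
  the coordinates of the chart \<open>c\<close>, at the point with coordinates \<open>y\<close>. Tangent vectors are
  represented by elements of the model space, covectors by linear functions on it. Only charts of
  the atlas and \<open>y \<in> chart_range c\<close> matter.\<close>

type_synonym ('m, 'e) vfield = "('m, 'e) chart \<Rightarrow> 'e \<Rightarrow> 'e"
type_synonym ('m, 'e) form1 = "('m, 'e) chart \<Rightarrow> 'e \<Rightarrow> 'e \<Rightarrow> real"

definition differential ::
    "('m, 'e::euclidean_space) chart \<Rightarrow> ('n, 'f::euclidean_space) chart \<Rightarrow> ('m \<Rightarrow> 'n) \<Rightarrow> 'e \<Rightarrow> 'e \<Rightarrow> 'f" where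
  "differential c d f y = frechet_derivative (\<lambda>z. coord d (f (chart_inv c z))) (at y)"

text \<open>\<open>f\<^sup>*\<alpha> = \<alpha>\<close> and \<open>f\<^sub>*X = X\<close>. For \<open>f = id\<close> these are the transformation laws under a change of
  charts.\<close>

definition preserves_form ::
    "('m, 'e::euclidean_space) chart set \<Rightarrow> ('m \<Rightarrow> 'm) \<Rightarrow> ('m, 'e) form1 \<Rightarrow> bool" where
  "preserves_form A f \<alpha> \<longleftrightarrow>
     (\<forall>c\<in>A. \<forall>d\<in>A. \<forall>x\<in>chart_dom c. f x \<in> chart_dom d \<longrightarrow>
        (\<forall>v. \<alpha> d (coord d (f x)) (differential c d f (coord c x) v) = \<alpha> c (coord c x) v))"

definition preserves_vector_field ::
    "('m, 'e::euclidean_space) chart set \<Rightarrow> ('m \<Rightarrow> 'm) \<Rightarrow> ('m, 'e) vfield \<Rightarrow> bool" where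
  "preserves_vector_field A f X \<longleftrightarrow>
     (\<forall>c\<in>A. \<forall>d\<in>A. \<forall>x\<in>chart_dom c. f x \<in> chart_dom d \<longrightarrow>
        differential c d f (coord c x) (X c (coord c x)) = X d (coord d (f x)))"

definition smooth_form :: "('m, 'e::euclidean_space) chart set \<Rightarrow> ('m, 'e) form1 \<Rightarrow> bool" where
  "smooth_form A \<alpha> \<longleftrightarrow>
     (\<forall>c\<in>A. (\<forall>y\<in>chart_range c. linear (\<alpha> c y)) \<and> (\<forall>v. smooth_on (chart_range c) (\<lambda>y. \<alpha> c y v))) \<and>
     preserves_form A id \<alpha>"

definition smooth_vector_field :: "('m, 'e::euclidean_space) chart set \<Rightarrow> ('m, 'e) vfield \<Rightarrow> bool" where
  "smooth_vector_field A X \<longleftrightarrow>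
     (\<forall>c\<in>A. smooth_on (chart_range c) (X c)) \<and> preserves_vector_field A id X"

definition left_invariant_form ::
    "('m, 'e::euclidean_space) chart set \<Rightarrow> 'm monoid \<Rightarrow> ('m, 'e) form1 \<Rightarrow> bool" where
  "left_invariant_form A G \<alpha> \<longleftrightarrow>
     smooth_form A \<alpha> \<and> (\<forall>a\<in>carrier G. preserves_form A (\<lambda>x. a \<otimes>\<^bsub>G\<^esub> x) \<alpha>)"

definition left_invariant_vector_field ::
    "('m, 'e::euclidean_space) chart set \<Rightarrow> 'm monoid \<Rightarrow> ('m, 'e) vfield \<Rightarrow> bool" where
  "left_invariant_vector_field A G X \<longleftrightarrow>
     smooth_vector_field A X \<and> (\<forall>a\<in>carrier G. preserves_vector_field A (\<lambda>x. a \<otimes>\<^bsub>G\<^esub> x) X)"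

text \<open>The conventions are \<open>(\<alpha> \<and> \<beta>)(u,v) = \<alpha>(u)\<beta>(v) - \<alpha>(v)\<beta>(u)\<close> and
  \<open>d\<alpha>(X,Y) = X(\<alpha>(Y)) - Y(\<alpha>(X)) - \<alpha>([X,Y])\<close>. The following three operations act on the local
  representatives in a fixed chart; in \<open>ext_deriv\<close> the vectors \<open>u, v\<close> are extended as constants.\<close>

definition wedge :: "('e \<Rightarrow> real) \<Rightarrow> ('e \<Rightarrow> real) \<Rightarrow> 'e \<Rightarrow> 'e \<Rightarrow> real" where
  "wedge \<alpha> \<beta> u v = \<alpha> u * \<beta> v - \<alpha> v * \<beta> u"

definition ext_deriv :: "('e::euclidean_space \<Rightarrow> 'e \<Rightarrow> real) \<Rightarrow> 'e \<Rightarrow> 'e \<Rightarrow> 'e \<Rightarrow> real" where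
  "ext_deriv \<alpha> y u v =
     frechet_derivative (\<lambda>z. \<alpha> z v) (at y) u - frechet_derivative (\<lambda>z. \<alpha> z u) (at y) v"

definition lie_bracket :: "('e::euclidean_space \<Rightarrow> 'e) \<Rightarrow> ('e \<Rightarrow> 'e) \<Rightarrow> 'e \<Rightarrow> 'e" where
  "lie_bracket X Y y = frechet_derivative Y (at y) (X y) - frechet_derivative X (at y) (Y y)"

section \<open>Quaternionic contact structures on 7-manifolds\<close>

text \<open>Triples are indexed by the type \<^typ>\<open>3\<close>, coframes by the type \<^typ>\<open>7\<close>; in these types
  \<open>3 = 0\<close> and \<open>7 = 0\<close> respectively, so \<open>1,2,3\<close> and \<open>1,\<dots>,7\<close> enumerate them without repetition.\<close>

definition triple :: "'a \<Rightarrow> 'a \<Rightarrow> 'a \<Rightarrow> 3 \<Rightarrow> 'a" where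
  "triple a b c r = (if r = 1 then a else if r = 2 then b else c)"

text \<open>\<open>qc_structure A H g I \<eta>\<close>: a qc structure with globally defined contact forms. The fields \<open>g\<close>
  and \<open>I r\<close> are sections over \<open>H\<close> only, so everything about them is required on \<open>H\<close> only; they
  are smooth in the sense that they take smooth local sections of \<open>H\<close> to smooth functions and
  smooth local sections. Smoothness and invariance of \<open>H\<close> itself follow from those of \<open>\<eta>\<close>.\<close>

definition qc_structure ::
    "('m::{t2_space,second_countable_topology}, real^7) chart set \<Rightarrow>
     (('m, real^7) chart \<Rightarrow> real^7 \<Rightarrow> (real^7) set) \<Rightarrow>
     (('m, real^7) chart \<Rightarrow> real^7 \<Rightarrow> real^7 \<Rightarrow> real^7 \<Rightarrow> real) \<Rightarrow>
     (3 \<Rightarrow> ('m, real^7) chart \<Rightarrow> real^7 \<Rightarrow> real^7 \<Rightarrow> real^7) \<Rightarrow>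
     (3 \<Rightarrow> ('m, real^7) form1) \<Rightarrow> bool" where
  "qc_structure A H g I \<eta> \<longleftrightarrow>
     smooth_atlas A \<and>
     (\<forall>r. smooth_form A (\<eta> r)) \<and>
     (\<forall>c\<in>A. \<forall>y\<in>chart_range c.
        H c y = {X. \<forall>r. \<eta> r c y X = 0} \<and> dim (H c y) = 4 \<and>
        (\<forall>X\<in>H c y. \<forall>Y\<in>H c y. g c y X Y = g c y Y X) \<and>
        (\<forall>X\<in>H c y. \<forall>Y\<in>H c y. \<forall>Z\<in>H c y. \<forall>a b.
           g c y (a *\<^sub>R X + b *\<^sub>R Y) Z = a * g c y X Z + b * g c y Y Z) \<and>
        (\<forall>X\<in>H c y. X \<noteq> 0 \<longrightarrow> 0 < g c y X X) \<and>
        (\<forall>r. \<forall>X\<in>H c y. I r c y X \<in> H c y \<and> I r c y (I r c y X) = - X) \<and>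
        (\<forall>r. \<forall>X\<in>H c y. \<forall>Y\<in>H c y. \<forall>a b.
           I r c y (a *\<^sub>R X + b *\<^sub>R Y) = a *\<^sub>R I r c y X + b *\<^sub>R I r c y Y) \<and>
        (\<forall>r. \<forall>X\<in>H c y. \<forall>Y\<in>H c y. g c y (I r c y X) (I r c y Y) = g c y X Y) \<and>
        (\<forall>X\<in>H c y. I 1 c y (I 2 c y X) = I 3 c y X \<and> I 2 c y (I 1 c y X) = - I 3 c y X) \<and>
        (\<forall>r. \<forall>X\<in>H c y. \<forall>Y\<in>H c y. 2 * g c y (I r c y X) Y = ext_deriv (\<eta> r c) y X Y)) \<and>
     (\<forall>c\<in>A. \<forall>W X Y. open W \<and> W \<subseteq> chart_range c \<and> smooth_on W X \<and> smooth_on W Y \<and>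
        (\<forall>y\<in>W. X y \<in> H c y \<and> Y y \<in> H c y) \<longrightarrow>
        smooth_on W (\<lambda>y. g c y (X y) (Y y)) \<and> (\<forall>r. smooth_on W (\<lambda>y. I r c y (X y)))) \<and>
     (\<forall>c\<in>A. \<forall>d\<in>A. \<forall>x\<in>chart_dom c \<inter> chart_dom d.
        let y = coord c x; z = coord d x; T = differential c d id y in
        \<forall>X\<in>H c y. (\<forall>Y\<in>H c y. g d z (T X) (T Y) = g c y X Y) \<and>
                    (\<forall>r. I r d z (T X) = T (I r c y X)))"

text \<open>Reeb vector fields, in the sense of Biquard and (for dimension 7) Duchemin. A qc structure is
  integrable if they exist and the vertical distribution spanned by them is involutive.\<close>

definition reeb_fields ::
    "('m, real^7) chart set \<Rightarrow> (('m, real^7) chart \<Rightarrow> real^7 \<Rightarrow> (real^7) set) \<Rightarrow>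
     (3 \<Rightarrow> ('m, real^7) form1) \<Rightarrow> (3 \<Rightarrow> ('m, real^7) vfield) \<Rightarrow> bool" where
  "reeb_fields A H \<eta> \<xi> \<longleftrightarrow>
     (\<forall>r. smooth_vector_field A (\<xi> r)) \<and>
     (\<forall>c\<in>A. \<forall>y\<in>chart_range c. \<forall>r s.
        \<eta> r c y (\<xi> s c y) = (if r = s then 1 else 0) \<and>
        (\<forall>X\<in>H c y. ext_deriv (\<eta> r c) y (\<xi> r c y) X = 0 \<and>
                    ext_deriv (\<eta> s c) y (\<xi> r c y) X = - ext_deriv (\<eta> r c) y (\<xi> s c y) X))"

definition qc_integrable ::
    "('m, real^7) chart set \<Rightarrow> (('m, real^7) chart \<Rightarrow> real^7 \<Rightarrow> (real^7) set) \<Rightarrow>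
     (3 \<Rightarrow> ('m, real^7) form1) \<Rightarrow> bool" where
  "qc_integrable A H \<eta> \<longleftrightarrow>
     (\<exists>\<xi>. reeb_fields A H \<eta> \<xi> \<and>
        (\<forall>c\<in>A. \<forall>y\<in>chart_range c. \<forall>r s.
           lie_bracket (\<xi> r c) (\<xi> s c) y \<in> span (range (\<lambda>t. \<xi> t c y))))"

section \<open>The quaternionic Heisenberg group and qc conformal flatness\<close>

text \<open>The quaternionic Heisenberg group is \<^typ>\<open>real^7\<close> with coordinates \<open>x\<^sup>1,\<dots>,x\<^sup>4\<close> on the
  quaternions and \<open>x\<^sup>5,x\<^sup>6,x\<^sup>7\<close> on the imaginary quaternions, and product
  \<open>(p,u)(q,w) = (p + q, u + w + Im(p q\<^sup>*))\<close>, where \<open>q\<^sup>*\<close> is the conjugate of \<open>q\<close>. The left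
  invariant coframe with \<open>\<theta>\<^sup>i = dx\<^sup>i\<close> at the identity is given below in these coordinates; the
  lemmas confirm its left invariance and the defining structure equations.\<close>

definition heis_mult :: "real^7 \<Rightarrow> real^7 \<Rightarrow> real^7" where
  "heis_mult p q = p + q + (\<chi> i.
     if i = 5 then p$2 * q$1 - p$1 * q$2 + p$4 * q$3 - p$3 * q$4
     else if i = 6 then p$3 * q$1 - p$1 * q$3 + p$2 * q$4 - p$4 * q$2
     else if i = 7 then p$4 * q$1 - p$1 * q$4 + p$3 * q$2 - p$2 * q$3
     else 0)"

definition heis_coframe :: "7 \<Rightarrow> real^7 \<Rightarrow> real^7 \<Rightarrow> real" where
  "heis_coframe i x v = v$i +
     (if i = 5 then x$1 * v$2 - x$2 * v$1 + x$3 * v$4 - x$4 * v$3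
      else if i = 6 then x$1 * v$3 - x$3 * v$1 + x$4 * v$2 - x$2 * v$4
      else if i = 7 then x$1 * v$4 - x$4 * v$1 + x$2 * v$3 - x$3 * v$2
      else 0)"

lemma heis_left_invariant:
  "heis_coframe i (heis_mult p x) (frechet_derivative (heis_mult p) (at x) v) = heis_coframe i x v"
proof -
  let ?L = "\<lambda>v. heis_mult p v - p"
  have "linear ?L"
    by (rule linearI) (simp_all add: heis_mult_def vec_eq_iff algebra_simps)
  then have "(?L has_derivative ?L) (at x)"
    by (simp add: linear_conv_bounded_linear bounded_linear_imp_has_derivative)
  then have "((\<lambda>v. ?L v + p) has_derivative ?L) (at x)"
    by (rule has_derivative_add_const)
  then have "frechet_derivative (heis_mult p) (at x) = ?L"
    by (simp add: frechet_derivative_at[symmetric])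
  then show ?thesis
    by (simp add: heis_coframe_def heis_mult_def algebra_simps)
qed

lemma heis_structure_equations:
  fixes x u v :: "real^7"
  defines "w \<equiv> \<lambda>i j. wedge (heis_coframe i x) (heis_coframe j x) u v"
  shows "i \<in> {1,2,3,4} \<Longrightarrow> ext_deriv (heis_coframe i) x u v = 0"
    and "ext_deriv (heis_coframe 5) x u v = 2 * (w 1 2 + w 3 4)"
    and "ext_deriv (heis_coframe 6) x u v = 2 * (w 1 3 + w 4 2)"
    and "ext_deriv (heis_coframe 7) x u v = 2 * (w 1 4 + w 2 3)"
proof -
  have D: "frechet_derivative (\<lambda>z. heis_coframe i z b) (at x) a = heis_coframe i a b - b $ i"
    for i :: 7 and a b
  proof -
    let ?L = "\<lambda>z. heis_coframe i z b - b $ i"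
    have "linear ?L"
      by (rule linearI) (simp_all add: heis_coframe_def algebra_simps)
    then have "(?L has_derivative ?L) (at x)"
      by (simp add: linear_conv_bounded_linear bounded_linear_imp_has_derivative)
    then have "((\<lambda>z. ?L z + b $ i) has_derivative ?L) (at x)"
      by (rule has_derivative_add_const)
    then show ?thesis
      by (simp add: frechet_derivative_at[symmetric])
  qed
  show "i \<in> {1,2,3,4} \<Longrightarrow> ext_deriv (heis_coframe i) x u v = 0"
    unfolding ext_deriv_def D by (auto simp: heis_coframe_def)
  show "ext_deriv (heis_coframe 5) x u v = 2 * (w 1 2 + w 3 4)"
    "ext_deriv (heis_coframe 6) x u v = 2 * (w 1 3 + w 4 2)"
    "ext_deriv (heis_coframe 7) x u v = 2 * (w 1 4 + w 2 3)"
    unfolding ext_deriv_def D w_def wedge_def by (simp_all add: heis_coframe_def algebra_simps)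
qed

definition heis_contact :: "3 \<Rightarrow> real^7 \<Rightarrow> real^7 \<Rightarrow> real" where
  "heis_contact = triple (heis_coframe 5) (heis_coframe 6) (heis_coframe 7)"

text \<open>\<open>U\<close> is the neighbourhood of \<open>p\<close>, and \<open>F\<close> the diffeomorphism of \<open>U\<close> onto an open subset of \<open>G(H)\<close>.
  The last clause says \<open>F\<^sup>*\<theta>\<^sup>4\<^sup>+\<^sup>r = \<nu> \<Sum>\<^sub>s \<Psi>\<^sub>r\<^sub>s \<eta>\<^sub>s\<close> on \<open>U\<close>.\<close>

definition locally_qc_conformally_flat ::
    "('m::{t2_space,second_countable_topology}, real^7) chart set \<Rightarrow> (3 \<Rightarrow> ('m, real^7) form1) \<Rightarrow> bool" where
  "locally_qc_conformally_flat A \<eta> \<longleftrightarrow>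
     (\<forall>p. \<exists>U F \<nu> \<Psi>.
        open U \<and> p \<in> U \<and>
        smooth_map A euclidean_atlas U F \<and> inj_on F U \<and> open (F ` U) \<and>
        smooth_map euclidean_atlas A (F ` U) (inv_into U F) \<and>
        smooth_map A euclidean_atlas U (\<nu> :: 'm \<Rightarrow> real) \<and> (\<forall>x\<in>U. 0 < \<nu> x) \<and>
        smooth_map A euclidean_atlas U (\<Psi> :: 'm \<Rightarrow> real^3^3) \<and> (\<forall>x\<in>U. rotation_matrix (\<Psi> x)) \<and>
        (\<forall>c\<in>A. \<forall>x\<in>U \<inter> chart_dom c. \<forall>r v.
           heis_contact r (F x) (differential c (UNIV, id) F (coord c x) v) =
             \<nu> x * (\<Sum>s\<in>UNIV. \<Psi> x $ r $ s * \<eta> s c (coord c x) v)))"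

section \<open>The group \<open>G\<^sub>1\<close>\<close>

definition G1_structure_equations ::
    "('m, real^7) chart set \<Rightarrow> (7 \<Rightarrow> ('m, real^7) form1) \<Rightarrow> bool" where
  "G1_structure_equations A e \<longleftrightarrow>
     (\<forall>c\<in>A. \<forall>y\<in>chart_range c. \<forall>u v.
        let d = (\<lambda>i. ext_deriv (e i c) y u v);
            w = (\<lambda>i j. wedge (e i c y) (e j c y) u v)
        in d 1 = 0 \<and>
           d 2 = 1/2 * w 1 5 - w 3 4 + 1/2 * w 4 6 \<and>
           d 3 = 1/2 * w 1 6 + w 2 4 - 1/2 * w 4 5 \<and>
           d 4 = - 2 * w 1 4 \<and>
           d 5 = 2 * (w 1 2 + w 3 4) - w 4 6 \<and>
           d 6 = 2 * (w 1 3 + w 4 2) + w 4 5 \<and>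
           d 7 = 2 * (w 1 4 + w 2 3) - 1/2 * w 5 6)"

definition G1_contact :: "(7 \<Rightarrow> ('m, real^7) form1) \<Rightarrow> 3 \<Rightarrow> ('m, real^7) form1" where
  "G1_contact e = triple (e 5) (e 6) (e 7)"

definition G1_horizontal ::
    "(7 \<Rightarrow> ('m, real^7) vfield) \<Rightarrow> ('m, real^7) chart \<Rightarrow> real^7 \<Rightarrow> (real^7) set" where
  "G1_horizontal E c y = span {E 1 c y, E 2 c y, E 3 c y, E 4 c y}"

text \<open>The metric on \<open>H\<close> for which \<open>e\<^sub>1,\<dots>,e\<^sub>4\<close> are orthonormal.\<close>

definition G1_metric ::
    "(7 \<Rightarrow> ('m, real^7) form1) \<Rightarrow> ('m, real^7) chart \<Rightarrow> real^7 \<Rightarrow> real^7 \<Rightarrow> real^7 \<Rightarrow> real" where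
  "G1_metric e c y X Y = (\<Sum>i\<in>{1,2,3,4}. e i c y X * e i c y Y)"

definition G1_omega ::
    "(7 \<Rightarrow> ('m, real^7) form1) \<Rightarrow> 3 \<Rightarrow> ('m, real^7) chart \<Rightarrow> real^7 \<Rightarrow> real^7 \<Rightarrow> real^7 \<Rightarrow> real" where
  "G1_omega e r c y X Y =
     (let w = (\<lambda>i j. wedge (e i c y) (e j c y) X Y)
      in triple (w 1 2 + w 3 4) (w 1 3 + w 4 2) (w 1 4 + w 2 3) r)"

end

theory Submission
  imports Defs
begin

text \<open>That the structure is quaternionic contact and integrable, with Reeb fields \<open>e\<^sub>5, e\<^sub>6, e\<^sub>7\<close>, is read
  off from the structure equations. The substance is that it is not conformally flat, and the
  argument replaces the curvature tensor by the integrability of complex null planes.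

  Call a complex 2-plane in \<open>H \<otimes> \<complex>\<close> null if \<open>\<omega>\<^sub>1, \<omega>\<^sub>2, \<omega>\<^sub>3\<close> vanish on it. At each point the null planes
  form a projective line; those near \<open>span(e\<^sub>1 + i e\<^sub>2, e\<^sub>3 - i e\<^sub>4)\<close> are
  spanned by \<open>Z\<^sub>1 = e\<^sub>1 + i e\<^sub>2 + \<mu> (e\<^sub>3 + i e\<^sub>4)\<close> and \<open>Z\<^sub>2 = e\<^sub>3 - i e\<^sub>4 - \<mu> (e\<^sub>1 - i e\<^sub>2)\<close>. The bracket of
  two sections of a null plane field is horizontal, since its vertical part is a combination of the
  \<open>\<omega>\<^sub>r(Z\<^sub>1, Z\<^sub>2)\<close>. The notion depends only on the span of the \<open>\<omega>\<^sub>r\<close>, so a qc conformal map carries null planes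
  to null planes. On the Heisenberg group a null plane at a point extends to a left invariant one,
  which is involutive: it is the common kernel in \<open>H \<otimes> \<complex>\<close> of the differentials of two complex linear
  functions of the coordinates \<open>x\<^sup>1,\<dots>,x\<^sup>4\<close>. Hence on a flat manifold every null plane at a point extends to an
  involutive field of null planes, with a smooth slope \<open>\<mu>\<close>.

  On \<open>G\<^sub>1\<close> involutivity amounts to
    \<open>Z\<^sub>1 \<mu> = 3/2 \<mu> (1 - \<mu>\<^sup>2)\<close> and \<open>Z\<^sub>2 \<mu> = 3/2 (\<mu>\<^sup>2 - 1)\<close>,
  and comparing \<open>[Z\<^sub>1, Z\<^sub>2] \<mu>\<close> computed from these equations with its value from the structure equations
  gives \<open>3 (1 - \<mu>\<^sup>2)\<^sup>2 = 0\<close>; this binary quartic takes the place of the qc conformal curvature. It does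
  not vanish at \<open>\<mu> = 0\<close>, and a flat structure would admit a solution that is \<open>0\<close> at a chosen point.

  The lemma \<open>null_coordinates_impossible\<close> derives the contradiction from two complex functions whose
  horizontal differentials span the annihilator of a null plane at every point. The lemma
  \<open>no_flattening_map\<close> obtains these functions from a flattening map: its horizontal Jacobian
  pulls the span of the \<open>\<omega>\<^sub>r\<close> back to itself, and, by \<open>quat_form_conformal_transpose\<close>, so does its transpose,
  which is what is needed for covectors.\<close>

section \<open>Calculus of smooth functions\<close>

lemma times_differentiable_on_cong:
  assumes "open S" "\<And>x. x \<in> S \<Longrightarrow> f x = g x"
  shows "times_differentiable_on k S f \<longleftrightarrow> times_differentiable_on k S g"
  using assms(2)
proof (induction k arbitrary: f g)
  case 0
  then show ?case by (simp cong: continuous_on_cong)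
next
  case (Suc k)
  have ev: "\<forall>\<^sub>F z in nhds x. f z = g z" if "x \<in> S" for x
    using that Suc.prems \<open>open S\<close> eventually_nhds by blast
  have d: "(f has_derivative L) (at x) \<longleftrightarrow> (g has_derivative L) (at x)" if "x \<in> S" for x L
    using has_derivative_transform_eventually[of f L x UNIV g]
      has_derivative_transform_eventually[of g L x UNIV f] ev[OF that] Suc.prems[OF that]
    by (metis (mono_tags, lifting) UNIV_I eventually_mono eventually_nhds_conv_at)
  then have "f differentiable at x \<longleftrightarrow> g differentiable at x"
    and "frechet_derivative f (at x) = frechet_derivative g (at x)" if "x \<in> S" for x
    using that by (simp_all add: differentiable_def frechet_derivative_def)
  then show ?case
    using Suc.IH[of "\<lambda>x. frechet_derivative f (at x) v" "\<lambda>x. frechet_derivative g (at x) v" for v]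
    by auto
qed

lemma times_differentiable_on_subset:
  "times_differentiable_on k S f \<Longrightarrow> T \<subseteq> S \<Longrightarrow> times_differentiable_on k T f"
  by (induction k arbitrary: f) (auto intro: continuous_on_subset)

lemma times_differentiable_on_SucD:
  "times_differentiable_on (Suc k) S f \<Longrightarrow> times_differentiable_on k S f"
proof (induction k arbitrary: f)
  case 0
  then show ?case
    by (auto intro!: continuous_at_imp_continuous_on differentiable_imp_continuous_within)
next
  case (Suc k)
  then show ?case by (metis times_differentiable_on.simps(2))
qed

lemma times_differentiable_on_const: "times_differentiable_on k S (\<lambda>x. c)"
  by (induction k arbitrary: c) auto

lemma times_differentiable_on_add:
  assumes "times_differentiable_on k S f" "times_differentiable_on k S g" "open S"
  shows "times_differentiable_on k S (\<lambda>x. f x + g x)"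
  using assms(1,2)
proof (induction k arbitrary: f g)
  case 0
  then show ?case by (auto intro: continuous_on_add)
next
  case (Suc k)
  have "frechet_derivative (\<lambda>x. f x + g x) (at x) v =
      frechet_derivative f (at x) v + frechet_derivative g (at x) v" if "x \<in> S" for x v
  proof -
    have "((\<lambda>x. f x + g x) has_derivative
        (\<lambda>v. frechet_derivative f (at x) v + frechet_derivative g (at x) v)) (at x)"
      using that Suc.prems by (intro has_derivative_add) (auto simp: frechet_derivative_works[symmetric])
    then show ?thesis by (simp add: frechet_derivative_at[symmetric])
  qed
  then have "times_differentiable_on k S (\<lambda>x. frechet_derivative (\<lambda>x. f x + g x) (at x) v)" for v
    by (subst times_differentiable_on_cong[OF \<open>open S\<close>]) (use Suc in auto)
  then show ?case using Suc.prems by auto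
qed

lemma frechet_derivative_bilinear:
  assumes "bounded_bilinear B" "f differentiable at x" "g differentiable at x"
  shows "(\<lambda>x. B (f x) (g x)) differentiable at x"
    and "frechet_derivative (\<lambda>x. B (f x) (g x)) (at x) v =
      B (f x) (frechet_derivative g (at x) v) + B (frechet_derivative f (at x) v) (g x)"
proof -
  note * = bounded_bilinear.FDERIV[OF assms(1) assms(2,3)[unfolded frechet_derivative_works]]
  show "(\<lambda>x. B (f x) (g x)) differentiable at x"
    using * differentiable_def by blast
  show "frechet_derivative (\<lambda>x. B (f x) (g x)) (at x) v =
      B (f x) (frechet_derivative g (at x) v) + B (frechet_derivative f (at x) v) (g x)"
    by (simp add: frechet_derivative_at[OF *, symmetric])
qed

lemma times_differentiable_on_bilinear:
  assumes "times_differentiable_on k S f" "times_differentiable_on k S g" "open S"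
    "bounded_bilinear B"
  shows "times_differentiable_on k S (\<lambda>x. B (f x) (g x))"
  using assms(1,2)
proof (induction k arbitrary: f g)
  case 0
  then show ?case using assms(4) by (auto intro: bounded_bilinear.continuous_on)
next
  case (Suc k)
  have "times_differentiable_on k S (\<lambda>x. frechet_derivative (\<lambda>x. B (f x) (g x)) (at x) v)" for v
    by (subst times_differentiable_on_cong[OF \<open>open S\<close>
          frechet_derivative_bilinear(2)[OF assms(4)]])
      (use Suc times_differentiable_on_SucD[OF Suc.prems(1)]
         times_differentiable_on_SucD[OF Suc.prems(2)] assms(3)
        in \<open>auto intro!: times_differentiable_on_add\<close>)
  then show ?case
    using Suc.prems frechet_derivative_bilinear(1)[OF assms(4), of f _ g] by simp
qed

lemma times_differentiable_on_inverse:
  fixes f :: "'a::euclidean_space \<Rightarrow> 'b::real_normed_field"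
  assumes "times_differentiable_on k S f" "open S" "\<And>x. x \<in> S \<Longrightarrow> f x \<noteq> 0"
  shows "times_differentiable_on k S (\<lambda>x. inverse (f x))"
  using assms(1)
proof (induction k)
  case 0
  then show ?case using assms(3) by (auto intro: continuous_on_inverse)
next
  case (Suc k)
  have d: "((\<lambda>x. inverse (f x)) has_derivative
      (\<lambda>v. - (inverse (f x) * frechet_derivative f (at x) v * inverse (f x)))) (at x)"
    if "x \<in> S" for x
    using that Suc.prems assms(3)
    by (intro Deriv.has_derivative_inverse) (auto simp: frechet_derivative_works[symmetric])
  have "times_differentiable_on k S
      (\<lambda>x. (-1) * (inverse (f x) * frechet_derivative f (at x) v * inverse (f x)))" for v
    using Suc times_differentiable_on_SucD[OF Suc.prems] assms(2)
    by (intro times_differentiable_on_bilinear[OF _ _ _ bounded_bilinear_mult]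
        times_differentiable_on_const) auto
  then have "times_differentiable_on k S (\<lambda>x. frechet_derivative (\<lambda>x. inverse (f x)) (at x) v)" for v
    by (subst times_differentiable_on_cong[OF assms(2)])
      (auto simp: frechet_derivative_at[OF d, symmetric])
  moreover have "\<forall>x\<in>S. (\<lambda>x. inverse (f x)) differentiable at x"
    using d unfolding differentiable_def by blast
  ultimately show ?case by simp
qed

lemma smooth_on_cong:
  "open S \<Longrightarrow> (\<And>x. x \<in> S \<Longrightarrow> f x = g x) \<Longrightarrow> smooth_on S f \<longleftrightarrow> smooth_on S g"
  unfolding smooth_on_def by (meson times_differentiable_on_cong)

lemma smooth_on_subset: "smooth_on S f \<Longrightarrow> T \<subseteq> S \<Longrightarrow> smooth_on T f"
  unfolding smooth_on_def by (meson times_differentiable_on_subset)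

lemma smooth_on_const: "smooth_on S (\<lambda>x. c)"
  by (simp add: smooth_on_def times_differentiable_on_const)

lemma smooth_on_add: "smooth_on S f \<Longrightarrow> smooth_on S g \<Longrightarrow> open S \<Longrightarrow> smooth_on S (\<lambda>x. f x + g x)"
  by (simp add: smooth_on_def times_differentiable_on_add)

lemma smooth_on_bilinear:
  "bounded_bilinear B \<Longrightarrow> smooth_on S f \<Longrightarrow> smooth_on S g \<Longrightarrow> open S \<Longrightarrow> smooth_on S (\<lambda>x. B (f x) (g x))"
  by (simp add: smooth_on_def times_differentiable_on_bilinear)

lemmas smooth_on_mult = smooth_on_bilinear[OF bounded_bilinear_mult]
lemmas smooth_on_scaleR = smooth_on_bilinear[OF bounded_bilinear_scaleR]
lemmas smooth_on_inner = smooth_on_bilinear[OF bounded_bilinear_inner]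

lemma smooth_on_inverse:
  fixes f :: "'a::euclidean_space \<Rightarrow> 'b::real_normed_field"
  shows "smooth_on S f \<Longrightarrow> open S \<Longrightarrow> (\<And>x. x \<in> S \<Longrightarrow> f x \<noteq> 0) \<Longrightarrow> smooth_on S (\<lambda>x. inverse (f x))"
  by (simp add: smooth_on_def times_differentiable_on_inverse)

lemma smooth_on_sum:
  "open S \<Longrightarrow> (\<And>i. i \<in> J \<Longrightarrow> smooth_on S (f i)) \<Longrightarrow> smooth_on S (\<lambda>x. \<Sum>i\<in>J. f i x)"
  by (induction J rule: infinite_finite_induct) (auto intro: smooth_on_const smooth_on_add)

lemma smooth_on_frechet_derivative:
  "smooth_on S f \<Longrightarrow> smooth_on S (\<lambda>x. frechet_derivative f (at x) v)"
  unfolding smooth_on_def by (metis times_differentiable_on.simps(2))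

lemma smooth_on_differentiable: "smooth_on S f \<Longrightarrow> x \<in> S \<Longrightarrow> f differentiable at x"
  unfolding smooth_on_def by (metis times_differentiable_on.simps(2))

lemma smooth_on_continuous_on: "smooth_on S f \<Longrightarrow> continuous_on S f"
  unfolding smooth_on_def by (metis times_differentiable_on.simps(1))

lemma linear_frechet_derivative_smooth_on: "smooth_on S f \<Longrightarrow> x \<in> S \<Longrightarrow> linear (frechet_derivative f (at x))"
  using smooth_on_differentiable linear_frechet_derivative by blast

lemma smooth_on_uminus:
  assumes "smooth_on S f" "open S"
  shows "smooth_on S (\<lambda>x. - f x)"
  using smooth_on_scaleR[OF smooth_on_const[of S "-1"] assms] by simp

lemma smooth_on_diff:
  assumes "smooth_on S f" "smooth_on S g" "open S"
  shows "smooth_on S (\<lambda>x. f x - g x)"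
  using smooth_on_add[OF assms(1) smooth_on_uminus[OF assms(2,3)] assms(3)] by simp

lemma smooth_on_component:
  fixes f :: "'a::euclidean_space \<Rightarrow> real^'n"
  shows "smooth_on S f \<Longrightarrow> open S \<Longrightarrow> smooth_on S (\<lambda>x. f x $ i)"
  using smooth_on_inner[OF _ smooth_on_const, of S f "axis i 1"] by (simp add: inner_axis)

lemma linear_expansion:
  fixes L :: "'a::euclidean_space \<Rightarrow> 'b::real_vector"
  assumes "linear L"
  shows "L v = (\<Sum>b\<in>Basis. (v \<bullet> b) *\<^sub>R L b)"
proof -
  interpret linear L by fact
  show ?thesis
    by (metis (no_types, lifting) euclidean_representation scaleR sum sum.cong)
qed

lemma smooth_on_contraction:
  fixes \<alpha> :: "'a::euclidean_space \<Rightarrow> 'c::euclidean_space \<Rightarrow> 'b::real_normed_vector"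
  assumes "open S" "\<And>z. z \<in> S \<Longrightarrow> linear (\<alpha> z)" "\<And>v. smooth_on S (\<lambda>z. \<alpha> z v)" "smooth_on S Y"
  shows "smooth_on S (\<lambda>z. \<alpha> z (Y z))"
proof -
  have expand: "\<alpha> z (Y z) = (\<Sum>b\<in>Basis. (Y z \<bullet> b) *\<^sub>R \<alpha> z b)" if "z \<in> S" for z
    using assms(2)[OF that] by (rule linear_expansion)
  have "smooth_on S (\<lambda>z. \<Sum>b\<in>Basis. (Y z \<bullet> b) *\<^sub>R \<alpha> z b)"
    by (intro smooth_on_sum smooth_on_scaleR smooth_on_inner smooth_on_const assms)
  then show ?thesis
    using smooth_on_cong[OF assms(1) expand] by simp
qed

lemma smooth_on_directional_derivative:
  assumes "smooth_on S f" "smooth_on S X" "open S"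
  shows "smooth_on S (\<lambda>x. frechet_derivative f (at x) (X x))"
  by (rule smooth_on_contraction[where \<alpha>="\<lambda>x. frechet_derivative f (at x)", OF assms(3)
        linear_frechet_derivative_smooth_on[OF assms(1)] smooth_on_frechet_derivative[OF assms(1)] assms(2)])

lemma smooth_on_linear:
  fixes L :: "'c::euclidean_space \<Rightarrow> 'b::real_normed_vector"
  assumes "linear L" "smooth_on S f" "open S"
  shows "smooth_on S (\<lambda>x. L (f x))"
  by (rule smooth_on_contraction[where \<alpha>="\<lambda>_. L", OF assms(3,1) smooth_on_const assms(2)])

text \<open>The second difference \<open>u(y + ha + hb) - u(y + ha) - u(y + hb) + u(y)\<close> is symmetric in \<open>a\<close> and \<open>b\<close>,
  and the mean value theorem, applied once in each direction, turns it into a mixed second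
  derivative at a nearby point. Exchanging \<open>a\<close> and \<open>b\<close> and letting \<open>h\<close> tend to \<open>0\<close> therefore proves that mixed
  derivatives agree.\<close>

lemma second_difference_mean_value:
  fixes u :: "'a::euclidean_space \<Rightarrow> real"
  assumes d: "\<And>s t. 0 \<le> s \<Longrightarrow> s \<le> h \<Longrightarrow> 0 \<le> t \<Longrightarrow> t \<le> h \<Longrightarrow> u differentiable at (y + s *\<^sub>R a + t *\<^sub>R b)"
    and d2: "\<And>s t. 0 \<le> s \<Longrightarrow> s \<le> h \<Longrightarrow> 0 \<le> t \<Longrightarrow> t \<le> h \<Longrightarrow>
      (\<lambda>z. frechet_derivative u (at z) b) differentiable at (y + s *\<^sub>R a + t *\<^sub>R b)"
    and "0 < h"
  obtains s t where "0 \<le> s" "s \<le> h" "0 \<le> t" "t \<le> h"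
    "u (y + h *\<^sub>R a + h *\<^sub>R b) - u (y + h *\<^sub>R a) - (u (y + h *\<^sub>R b) - u y) =
      h * h * frechet_derivative (\<lambda>z. frechet_derivative u (at z) b) (at (y + s *\<^sub>R a + t *\<^sub>R b)) a"
proof -
  have line: "((\<lambda>t. g (c + t *\<^sub>R v)) has_derivative
      (\<lambda>r. r * frechet_derivative g (at (c + t *\<^sub>R v)) v)) (at t within T)"
    if "g differentiable at (c + t *\<^sub>R v)" for g :: "'a \<Rightarrow> real" and c v t T
  proof -
    have g: "(g has_derivative frechet_derivative g (at (c + t *\<^sub>R v))) (at (c + t *\<^sub>R v))"
      using that frechet_derivative_works by blast
    have "((\<lambda>t. c + t *\<^sub>R v) has_derivative (\<lambda>r. r *\<^sub>R v)) (at t within T)"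
      by (auto intro!: derivative_eq_intros)
    from has_derivative_compose[OF this g] show ?thesis
      using linear_frechet_derivative[OF that] by (simp add: linear_cmul)
  qed
  have "\<exists>t\<in>{0<..<h}. (u (y + h *\<^sub>R a + h *\<^sub>R b) - u (y + h *\<^sub>R b)) -
      (u (y + h *\<^sub>R a + 0 *\<^sub>R b) - u (y + 0 *\<^sub>R b)) =
      (h - 0) * frechet_derivative u (at (y + h *\<^sub>R a + t *\<^sub>R b)) b -
      (h - 0) * frechet_derivative u (at (y + t *\<^sub>R b)) b"
    using d[of h] d[of 0] \<open>0 < h\<close>
    by (intro mvt_simple has_derivative_diff line) auto
  then obtain t where t: "0 < t" "t < h" and
    e1: "(u (y + h *\<^sub>R a + h *\<^sub>R b) - u (y + h *\<^sub>R b)) - (u (y + h *\<^sub>R a) - u y) =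
      h * (frechet_derivative u (at (y + h *\<^sub>R a + t *\<^sub>R b)) b -
           frechet_derivative u (at (y + t *\<^sub>R b)) b)"
    by (auto simp: algebra_simps)
  have "\<exists>s\<in>{0<..<h}. frechet_derivative u (at (y + t *\<^sub>R b + h *\<^sub>R a)) b -
      frechet_derivative u (at (y + t *\<^sub>R b + 0 *\<^sub>R a)) b =
      (h - 0) * frechet_derivative (\<lambda>z. frechet_derivative u (at z) b) (at (y + t *\<^sub>R b + s *\<^sub>R a)) a"
    using d2[of _ t] t \<open>0 < h\<close>
    by (intro mvt_simple line) (auto simp: add_ac)
  then obtain s where s: "0 < s" "s < h" and
    e2: "frechet_derivative u (at (y + h *\<^sub>R a + t *\<^sub>R b)) b - frechet_derivative u (at (y + t *\<^sub>R b)) b =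
      h * frechet_derivative (\<lambda>z. frechet_derivative u (at z) b) (at (y + s *\<^sub>R a + t *\<^sub>R b)) a"
    by (auto simp: add_ac)
  show thesis
    by (rule that[of s t]) (use s t e1 e2 in \<open>auto simp: algebra_simps\<close>)
qed

lemma symmetric_second_derivative_real:
  fixes u :: "'a::euclidean_space \<Rightarrow> real"
  assumes "smooth_on S u" "open S" "y \<in> S"
  shows "frechet_derivative (\<lambda>z. frechet_derivative u (at z) b) (at y) a =
    frechet_derivative (\<lambda>z. frechet_derivative u (at z) a) (at y) b" (is "?P y = ?Q y")
proof (rule ccontr)
  assume ne: "?P y \<noteq> ?Q y"
  define \<epsilon> where "\<epsilon> = \<bar>?P y - ?Q y\<bar> / 2"
  have "\<epsilon> > 0" using ne by (simp add: \<epsilon>_def)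
  have "continuous_on S ?P" "continuous_on S ?Q"
    using assms(1) by (intro smooth_on_continuous_on smooth_on_frechet_derivative, assumption)+
  then have "isCont ?P y" "isCont ?Q y"
    using assms(2,3) continuous_on_eq_continuous_at by blast+
  then have "\<forall>\<^sub>F z in nhds y. dist (?P z) (?P y) < \<epsilon>" "\<forall>\<^sub>F z in nhds y. dist (?Q z) (?Q y) < \<epsilon>"
    using \<open>\<epsilon> > 0\<close> unfolding continuous_at tendsto_iff
    by (simp_all add: eventually_nhds_conv_at)
  moreover have "\<forall>\<^sub>F z in nhds y. z \<in> S"
    using assms(2,3) by (rule eventually_nhds_in_open)
  ultimately have "\<forall>\<^sub>F z in nhds y. dist (?P z) (?P y) < \<epsilon> \<and> dist (?Q z) (?Q y) < \<epsilon> \<and> z \<in> S"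
    by eventually_elim auto
  then obtain \<delta> where \<delta>: "\<delta> > 0"
    "\<And>z. dist z y < \<delta> \<Longrightarrow> dist (?P z) (?P y) < \<epsilon> \<and> dist (?Q z) (?Q y) < \<epsilon> \<and> z \<in> S"
    unfolding eventually_nhds_metric by blast
  \<comment> \<open>The step is so small that the whole parallelogram spanned by \<open>h a\<close> and \<open>h b\<close> stays within \<open>\<delta>\<close> of \<open>y\<close>.\<close>
  define h where "h = \<delta> / (2 * (norm a + norm b + 1))"
  have pos: "norm a + norm b + 1 > 0" by (simp add: add_nonneg_pos)
  then have "h > 0" using \<delta>(1) by (simp add: h_def)
  have "h * (norm a + norm b) < \<delta>"
  proof -
    have "h * (norm a + norm b) \<le> h * (norm a + norm b + 1)" using \<open>h > 0\<close> by simp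
    also have "\<dots> = \<delta> / 2" using pos by (simp add: h_def field_simps)
    also have "\<dots> < \<delta>" using \<delta>(1) by simp
    finally show ?thesis .
  qed
  have near: "dist (y + s *\<^sub>R v + t *\<^sub>R w) y < \<delta>"
    if "0 \<le> s" "s \<le> h" "0 \<le> t" "t \<le> h" "{v, w} = {a, b}" for s t v w
  proof -
    have "dist (y + s *\<^sub>R v + t *\<^sub>R w) y \<le> s * norm v + t * norm w"
      using that norm_triangle_ineq[of "s *\<^sub>R v" "t *\<^sub>R w"] by (simp add: dist_norm)
    also have "\<dots> \<le> h * norm v + h * norm w"
      using that by (intro add_mono mult_right_mono) auto
    also have "\<dots> = h * (norm a + norm b)"
      using that(5) by (auto simp: doubleton_eq_iff algebra_simps)
    finally show ?thesis using \<open>h * (norm a + norm b) < \<delta>\<close> by simp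
  qed
  have du: "u differentiable at z" "(\<lambda>z. frechet_derivative u (at z) v) differentiable at z"
    if "dist z y < \<delta>" for z v
    using \<delta>(2)[OF that] assms(1) smooth_on_differentiable smooth_on_frechet_derivative by blast+
  obtain s t where 1: "0 \<le> s" "s \<le> h" "0 \<le> t" "t \<le> h"
    "u (y + h *\<^sub>R a + h *\<^sub>R b) - u (y + h *\<^sub>R a) - (u (y + h *\<^sub>R b) - u y) =
      h * h * ?P (y + s *\<^sub>R a + t *\<^sub>R b)"
    by (rule second_difference_mean_value[of h u y a b]) (use near \<open>h > 0\<close> in \<open>blast intro: du\<close>)+
  obtain s' t' where 2: "0 \<le> s'" "s' \<le> h" "0 \<le> t'" "t' \<le> h"
    "u (y + h *\<^sub>R b + h *\<^sub>R a) - u (y + h *\<^sub>R b) - (u (y + h *\<^sub>R a) - u y) =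
      h * h * ?Q (y + s' *\<^sub>R b + t' *\<^sub>R a)"
    by (rule second_difference_mean_value[of h u y b a]) (use near \<open>h > 0\<close> in \<open>blast intro: du\<close>)+
  have "h * h * ?P (y + s *\<^sub>R a + t *\<^sub>R b) = h * h * ?Q (y + s' *\<^sub>R b + t' *\<^sub>R a)"
    unfolding 1(5)[symmetric] 2(5)[symmetric] by (simp add: add_ac)
  then have "?P (y + s *\<^sub>R a + t *\<^sub>R b) = ?Q (y + s' *\<^sub>R b + t' *\<^sub>R a)"
    using \<open>h > 0\<close> by simp
  moreover have "dist (?P (y + s *\<^sub>R a + t *\<^sub>R b)) (?P y) < \<epsilon>"
    "dist (?Q (y + s' *\<^sub>R b + t' *\<^sub>R a)) (?Q y) < \<epsilon>"
    using \<delta>(2)[OF near[OF 1(1-4), of a b]] \<delta>(2)[OF near[OF 2(1-4), of b a]] by auto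
  ultimately show False
    unfolding \<epsilon>_def dist_real_def by (simp add: abs_if split: if_splits) 
qed

lemma symmetric_second_derivative:
  fixes u :: "'a::euclidean_space \<Rightarrow> 'b::euclidean_space"
  assumes "smooth_on S u" "open S" "y \<in> S"
  shows "frechet_derivative (\<lambda>z. frechet_derivative u (at z) b) (at y) a =
    frechet_derivative (\<lambda>z. frechet_derivative u (at z) a) (at y) b"
proof (rule euclidean_eqI)
  fix i :: 'b assume "i \<in> Basis"
  have inner: "frechet_derivative (\<lambda>z. g z \<bullet> i) (at z) v = frechet_derivative g (at z) v \<bullet> i"
    if "smooth_on S g" "z \<in> S" for g :: "'a \<Rightarrow> 'b" and z v
    using frechet_derivative_bilinear(2)[OF bounded_bilinear_inner
        smooth_on_differentiable[OF that], of "\<lambda>_. i"] by simp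
  have twice: "frechet_derivative (\<lambda>z. frechet_derivative (\<lambda>x. u x \<bullet> i) (at z) v) (at y) w =
      frechet_derivative (\<lambda>z. frechet_derivative u (at z) v) (at y) w \<bullet> i" for v w
  proof -
    have "frechet_derivative (\<lambda>z. frechet_derivative (\<lambda>x. u x \<bullet> i) (at z) v) (at y) =
      frechet_derivative (\<lambda>z. frechet_derivative u (at z) v \<bullet> i) (at y)"
    proof (rule frechet_derivative_transform_within_open[OF _ assms(2,3)])
      show "(\<lambda>z. frechet_derivative (\<lambda>x. u x \<bullet> i) (at z) v) differentiable at y"
        using assms by (intro smooth_on_differentiable[of S] smooth_on_frechet_derivative
            smooth_on_inner smooth_on_const) auto
    qed (simp add: inner assms)
    then show ?thesis
      using inner[OF smooth_on_frechet_derivative[OF assms(1)] assms(3)] by simp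
  qed
  have "smooth_on S (\<lambda>x. u x \<bullet> i)"
    using assms by (intro smooth_on_inner smooth_on_const)
  from symmetric_second_derivative_real[OF this assms(2,3), of b a]
  show "frechet_derivative (\<lambda>z. frechet_derivative u (at z) b) (at y) a \<bullet> i =
    frechet_derivative (\<lambda>z. frechet_derivative u (at z) a) (at y) b \<bullet> i"
    by (simp add: twice)
qed

section \<open>Fields, forms and brackets on open sets\<close>

text \<open>The product rule for the pairing of a covector field with a vector field. It is
  stated for a family of linear maps because it is also applied to the differential of a function.\<close>

lemma frechet_derivative_contraction:
  fixes \<alpha> :: "'a::euclidean_space \<Rightarrow> 'c::euclidean_space \<Rightarrow> 'b::real_normed_vector"
  assumes "open S" "y \<in> S" "\<And>z. z \<in> S \<Longrightarrow> linear (\<alpha> z)"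
    and "\<And>v. (\<lambda>z. \<alpha> z v) differentiable at y" and "Y differentiable at y"
  shows "frechet_derivative (\<lambda>z. \<alpha> z (Y z)) (at y) w =
    frechet_derivative (\<lambda>z. \<alpha> z (Y y)) (at y) w + \<alpha> y (frechet_derivative Y (at y) w)"
proof -
  have expand: "\<alpha> z v = (\<Sum>b\<in>Basis. (v \<bullet> b) *\<^sub>R \<alpha> z b)" if "z \<in> S" for z v
    using assms(3)[OF that] by (rule linear_expansion)
  have d\<alpha>: "((\<lambda>z. \<alpha> z v) has_derivative frechet_derivative (\<lambda>z. \<alpha> z v) (at y)) (at y)" for v
    using assms(4) frechet_derivative_works by blast
  have dY: "(Y has_derivative frechet_derivative Y (at y)) (at y)"
    using assms(5) frechet_derivative_works by blast
  have local: "(f has_derivative f') (at y)"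
    if "(g has_derivative f') (at y)" "\<And>z. z \<in> S \<Longrightarrow> g z = f z" for f g :: "'a \<Rightarrow> 'b" and f'
    using has_derivative_transform_within_open[OF that(1) assms(1,2)] that(2) by simp
  have "((\<lambda>z. \<Sum>b\<in>Basis. (Y z \<bullet> b) *\<^sub>R \<alpha> z b) has_derivative
      (\<lambda>w. \<Sum>b\<in>Basis. (Y y \<bullet> b) *\<^sub>R frechet_derivative (\<lambda>z. \<alpha> z b) (at y) w +
        (frechet_derivative Y (at y) w \<bullet> b) *\<^sub>R \<alpha> y b)) (at y)"
    by (intro has_derivative_sum has_derivative_scaleR d\<alpha> has_derivative_inner_left dY)
  note 1 = local[OF this expand[symmetric]]
  have "((\<lambda>z. \<Sum>b\<in>Basis. (Y y \<bullet> b) *\<^sub>R \<alpha> z b) has_derivative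
      (\<lambda>w. \<Sum>b\<in>Basis. (Y y \<bullet> b) *\<^sub>R frechet_derivative (\<lambda>z. \<alpha> z b) (at y) w)) (at y)"
    by (intro has_derivative_sum has_derivative_scaleR_right d\<alpha>)
  note 2 = local[OF this expand[symmetric]]
  show ?thesis
    by (simp add: frechet_derivative_at[OF 1, symmetric] frechet_derivative_at[OF 2, symmetric]
        sum.distrib expand[OF assms(2), of "frechet_derivative Y (at y) w"])
qed

text \<open>In \<open>ext_deriv\<close> the two vectors are extended as constants; for other extensions the derivatives of
  the fields combine to the bracket.\<close>

lemma ext_deriv_fields:
  assumes "open S" "y \<in> S" "\<And>z. z \<in> S \<Longrightarrow> linear (\<alpha> z)" "\<And>v. smooth_on S (\<lambda>z. \<alpha> z v)"
    and "smooth_on S X" "smooth_on S Y"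
  shows "ext_deriv \<alpha> y (X y) (Y y) = frechet_derivative (\<lambda>z. \<alpha> z (Y z)) (at y) (X y)
    - frechet_derivative (\<lambda>z. \<alpha> z (X z)) (at y) (Y y) - \<alpha> y (lie_bracket X Y y)"
proof -
  note * = frechet_derivative_contraction[where \<alpha>=\<alpha>, OF assms(1-3)
      smooth_on_differentiable[OF assms(4,2)] smooth_on_differentiable[OF _ assms(2)]]
  have "\<alpha> y (a - b) = \<alpha> y a - \<alpha> y b" for a b
    using assms(2,3) linear_diff by blast
  then show ?thesis
    by (simp add: ext_deriv_def lie_bracket_def *[OF _ assms(5)] *[OF _ assms(6)])
qed

text \<open>The second derivatives of \<open>u\<close> cancel by symmetry, so that only the derivatives of the fields remain.\<close>

lemma commutator_of_fields:
  fixes u :: "'a::euclidean_space \<Rightarrow> 'b::euclidean_space"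
  assumes "open S" "y \<in> S" "smooth_on S u" "smooth_on S X" "smooth_on S Y"
  shows "frechet_derivative (\<lambda>z. frechet_derivative u (at z) (Y z)) (at y) (X y)
    - frechet_derivative (\<lambda>z. frechet_derivative u (at z) (X z)) (at y) (Y y) =
    frechet_derivative u (at y) (lie_bracket X Y y)"
proof -
  note lin = linear_frechet_derivative_smooth_on[OF assms(3)]
  note * = frechet_derivative_contraction[where \<alpha>="\<lambda>z. frechet_derivative u (at z)", OF assms(1,2) lin
      smooth_on_differentiable[OF smooth_on_frechet_derivative[OF assms(3)] assms(2)]
      smooth_on_differentiable[OF _ assms(2)]]
  show ?thesis
    by (simp add: *[OF _ assms(4)] *[OF _ assms(5)] lie_bracket_def linear_diff[OF lin[OF assms(2)]]
        symmetric_second_derivative[OF assms(3,1,2), of "Y y"])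
qed

text \<open>The second derivative of \<open>f\<close> drops out of \<open>d(f\<^sup>*\<alpha>)\<close> by antisymmetry.\<close>

lemma ext_deriv_pullback:
  fixes \<alpha> :: "'b::euclidean_space \<Rightarrow> 'b \<Rightarrow> real" and f :: "'a::euclidean_space \<Rightarrow> 'b"
  assumes f: "smooth_on S f" "open S" "y \<in> S"
    and lin: "\<And>x. linear (\<alpha> x)" and diff: "\<And>x v. (\<lambda>x. \<alpha> x v) differentiable at x"
  shows "ext_deriv (\<lambda>z v. \<alpha> (f z) (frechet_derivative f (at z) v)) y u v =
    ext_deriv \<alpha> (f y) (frechet_derivative f (at y) u) (frechet_derivative f (at y) v)"
proof -
  have fy: "f differentiable at y" using f smooth_on_differentiable by blast
  have chain: "((\<lambda>z. \<alpha> (f z) v) has_derivative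
      (\<lambda>u. frechet_derivative (\<lambda>x. \<alpha> x v) (at (f y)) (frechet_derivative f (at y) u))) (at y)" for v
    using has_derivative_compose[OF fy[unfolded frechet_derivative_works] diff[unfolded frechet_derivative_works]] .
  have "frechet_derivative (\<lambda>z. \<alpha> (f z) (frechet_derivative f (at z) v)) (at y) u =
      frechet_derivative (\<lambda>x. \<alpha> x (frechet_derivative f (at y) v)) (at (f y)) (frechet_derivative f (at y) u)
      + \<alpha> (f y) (frechet_derivative (\<lambda>z. frechet_derivative f (at z) v) (at y) u)" for u v
    by (subst frechet_derivative_contraction[where \<alpha>="\<lambda>z. \<alpha> (f z)", OF f(2,3) lin])
      (use differentiableI[OF chain] smooth_on_differentiable[OF smooth_on_frechet_derivative[OF f(1)] f(3)] in
        \<open>auto simp: frechet_derivative_at[OF chain, symmetric]\<close>)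
  then show ?thesis
    by (simp add: ext_deriv_def symmetric_second_derivative[OF f, of u])
qed

section \<open>The coframe of the group in one chart\<close>

lemma exhaust_7:
  fixes x :: 7
  shows "x = 1 \<or> x = 2 \<or> x = 3 \<or> x = 4 \<or> x = 5 \<or> x = 6 \<or> x = 7"
proof (induct x)
  case (of_int z)
  then have "0 \<le> z" "z < 7" by simp_all
  then have "z = 0 \<or> z = 1 \<or> z = 2 \<or> z = 3 \<or> z = 4 \<or> z = 5 \<or> z = 6" by arith
  then show ?case by auto
qed

lemma forall_7: "(\<forall>i::7. P i) \<longleftrightarrow> P 1 \<and> P 2 \<and> P 3 \<and> P 4 \<and> P 5 \<and> P 6 \<and> P 7"
  by (metis exhaust_7)

lemma sum_7: "sum f (UNIV :: 7 set) = f 1 + f 2 + f 3 + f 4 + f 5 + f 6 + f 7"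
proof -
  have U: "(UNIV :: 7 set) = {1, 2, 3, 4, 5, 6, 7}" using exhaust_7 by auto
  show ?thesis unfolding U by (simp add: ac_simps)
qed

text \<open>The argument is local, so it is carried out on an open subset \<open>V\<close> of \<open>\<real>\<^sup>7\<close>: the range of a chart, or an
  open part of it on which a flattening map is defined.\<close>

locale G1_coframe =
  fixes V :: "(real^7) set"
    and e :: "7 \<Rightarrow> real^7 \<Rightarrow> real^7 \<Rightarrow> real"
    and E :: "7 \<Rightarrow> real^7 \<Rightarrow> real^7"
  assumes open_V: "open V"
    and linear_e: "y \<in> V \<Longrightarrow> linear (e i y)"
    and smooth_e: "smooth_on V (\<lambda>y. e i y v)"
    and smooth_E: "smooth_on V (E i)"
    and dual: "y \<in> V \<Longrightarrow> e i y (E j y) = (if i = j then 1 else 0)"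
    and structure_equations: "y \<in> V \<Longrightarrow> (let d = (\<lambda>i. ext_deriv (e i) y u v);
            w = (\<lambda>i j. wedge (e i y) (e j y) u v)
        in d 1 = 0 \<and>
           d 2 = 1/2 * w 1 5 - w 3 4 + 1/2 * w 4 6 \<and>
           d 3 = 1/2 * w 1 6 + w 2 4 - 1/2 * w 4 5 \<and>
           d 4 = - 2 * w 1 4 \<and>
           d 5 = 2 * (w 1 2 + w 3 4) - w 4 6 \<and>
           d 6 = 2 * (w 1 3 + w 4 2) + w 4 5 \<and>
           d 7 = 2 * (w 1 4 + w 2 3) - 1/2 * w 5 6)"
begin

lemma frame_expansion:
  assumes "y \<in> V"
  shows "v = (\<Sum>i\<in>UNIV. e i y v *\<^sub>R E i y)"
proof -
  define L where "L c = (\<Sum>i\<in>UNIV. c $ i *\<^sub>R E i y)" for c :: "real^7"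
  have "linear L"
    by (rule linearI) (simp_all add: L_def scaleR_left_distrib sum.distrib scaleR_sum_right)
  have eL: "e k y (L c) = c $ k" for k c
    using assms linear_e[OF assms]
    by (simp add: L_def linear_sum linear_cmul dual if_distrib cong: if_cong)
  have "inj L" by (rule injI) (metis eL vec_eq_iff)
  then have "surj L"
    using \<open>linear L\<close> linear_injective_imp_surjective by blast
  then obtain c where "v = L c" by (metis surjD)
  then show ?thesis using eL L_def by simp
qed

lemma ext_deriv_e:
  assumes "y \<in> V"
  shows "ext_deriv (e 1) y u v = 0"
    and "ext_deriv (e 2) y u v = 1/2 * wedge (e 1 y) (e 5 y) u v - wedge (e 3 y) (e 4 y) u v
        + 1/2 * wedge (e 4 y) (e 6 y) u v"
    and "ext_deriv (e 3) y u v = 1/2 * wedge (e 1 y) (e 6 y) u v + wedge (e 2 y) (e 4 y) u v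
        - 1/2 * wedge (e 4 y) (e 5 y) u v"
    and "ext_deriv (e 4) y u v = - 2 * wedge (e 1 y) (e 4 y) u v"
    and "ext_deriv (e 5) y u v = 2 * (wedge (e 1 y) (e 2 y) u v + wedge (e 3 y) (e 4 y) u v)
        - wedge (e 4 y) (e 6 y) u v"
    and "ext_deriv (e 6) y u v = 2 * (wedge (e 1 y) (e 3 y) u v + wedge (e 4 y) (e 2 y) u v)
        + wedge (e 4 y) (e 5 y) u v"
    and "ext_deriv (e 7) y u v = 2 * (wedge (e 1 y) (e 4 y) u v + wedge (e 2 y) (e 3 y) u v)
        - 1/2 * wedge (e 5 y) (e 6 y) u v"
  using structure_equations[OF assms, of u v] unfolding Let_def by blast+

text \<open>The functions \<open>e\<^sup>k(e\<^sub>j)\<close> are constant, so only the bracket term of \<open>de\<^sup>k(e\<^sub>i, e\<^sub>j)\<close> survives.\<close>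

lemma e_lie_bracket:
  assumes "y \<in> V"
  shows "e k y (lie_bracket (E i) (E j) y) = - ext_deriv (e k) y (E i y) (E j y)"
proof -
  have "frechet_derivative (\<lambda>z. e k z (E j z)) (at y) = (\<lambda>v. 0)" for j
  proof -
    have "((\<lambda>z. e k z (E j z)) has_derivative (\<lambda>v. 0)) (at y)"
      by (rule has_derivative_transform_within_open[OF has_derivative_const open_V assms])
        (simp add: dual)
    then show ?thesis by (simp add: frechet_derivative_at[symmetric])
  qed
  then show ?thesis
    using ext_deriv_fields[OF open_V assms linear_e smooth_e smooth_E smooth_E, of k i j] by simp
qed

lemma lie_bracket_E:
  assumes "y \<in> V"
  shows "lie_bracket (E i) (E j) y = - (\<Sum>k\<in>UNIV. ext_deriv (e k) y (E i y) (E j y) *\<^sub>R E k y)"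
  using frame_expansion[OF assms, of "lie_bracket (E i) (E j) y"]
  by (simp add: e_lie_bracket[OF assms] sum_negf)

lemma horizontal_brackets:
  assumes "y \<in> V"
  shows "lie_bracket (E 1) (E 2) y = - 2 *\<^sub>R E 5 y"
    and "lie_bracket (E 1) (E 3) y = - 2 *\<^sub>R E 6 y"
    and "lie_bracket (E 1) (E 4) y = 2 *\<^sub>R E 4 y - 2 *\<^sub>R E 7 y"
    and "lie_bracket (E 2) (E 3) y = - 2 *\<^sub>R E 7 y"
    and "lie_bracket (E 2) (E 4) y = 2 *\<^sub>R E 6 y - E 3 y"
    and "lie_bracket (E 3) (E 4) y = E 2 y - 2 *\<^sub>R E 5 y"
  by (simp_all add: lie_bracket_E[OF assms] sum_7 ext_deriv_e[OF assms] wedge_def dual[OF assms])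

definition D :: "7 \<Rightarrow> (real^7 \<Rightarrow> 'b::euclidean_space) \<Rightarrow> real^7 \<Rightarrow> 'b" where
  "D i u y = frechet_derivative u (at y) (E i y)"

lemma smooth_on_D: "open W \<Longrightarrow> W \<subseteq> V \<Longrightarrow> smooth_on W u \<Longrightarrow> smooth_on W (D i u)"
  unfolding D_def
  by (rule smooth_on_directional_derivative) (auto intro: smooth_on_subset smooth_E)

lemma D_commutator:
  fixes u :: "real^7 \<Rightarrow> 'b::euclidean_space"
  assumes "open W" "W \<subseteq> V" "smooth_on W u" "y \<in> W"
  shows "D 1 (D 2 u) y - D 2 (D 1 u) y = - 2 *\<^sub>R D 5 u y"
    and "D 1 (D 3 u) y - D 3 (D 1 u) y = - 2 *\<^sub>R D 6 u y"
    and "D 1 (D 4 u) y - D 4 (D 1 u) y = 2 *\<^sub>R D 4 u y - 2 *\<^sub>R D 7 u y"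
    and "D 2 (D 3 u) y - D 3 (D 2 u) y = - 2 *\<^sub>R D 7 u y"
    and "D 2 (D 4 u) y - D 4 (D 2 u) y = 2 *\<^sub>R D 6 u y - D 3 u y"
    and "D 3 (D 4 u) y - D 4 (D 3 u) y = D 2 u y - 2 *\<^sub>R D 5 u y"
proof -
  have y: "y \<in> V" using assms by blast
  have c: "D i (D j u) y - D j (D i u) y = frechet_derivative u (at y) (lie_bracket (E i) (E j) y)" for i j
    unfolding D_def
    by (rule commutator_of_fields[OF assms(1,4,3)]) (use assms(2) in \<open>auto intro: smooth_on_subset smooth_E\<close>)
  interpret linear "frechet_derivative u (at y)"
    using assms by (rule_tac linear_frechet_derivative_smooth_on)
  show "D 1 (D 2 u) y - D 2 (D 1 u) y = - 2 *\<^sub>R D 5 u y"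
    "D 1 (D 3 u) y - D 3 (D 1 u) y = - 2 *\<^sub>R D 6 u y"
    "D 1 (D 4 u) y - D 4 (D 1 u) y = 2 *\<^sub>R D 4 u y - 2 *\<^sub>R D 7 u y"
    "D 2 (D 3 u) y - D 3 (D 2 u) y = - 2 *\<^sub>R D 7 u y"
    "D 2 (D 4 u) y - D 4 (D 2 u) y = 2 *\<^sub>R D 6 u y - D 3 u y"
    "D 3 (D 4 u) y - D 4 (D 3 u) y = D 2 u y - 2 *\<^sub>R D 5 u y"
    unfolding c horizontal_brackets[OF y] by (simp_all add: D_def diff neg scaleR)
qed

lemma G1_coframe_subset:
  assumes "open W" "W \<subseteq> V"
  shows "G1_coframe W e E"
proof (rule G1_coframe.intro)
  fix y i j u v
  show "open W" by fact
  show "smooth_on W (\<lambda>y. e i y v)" "smooth_on W (E i)"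
    using smooth_e smooth_E assms(2) by (auto intro: smooth_on_subset)
  assume "y \<in> W"
  then have y: "y \<in> V" using assms(2) by blast
  show "linear (e i y)" by (rule linear_e[OF y])
  show "e i y (E j y) = (if i = j then 1 else 0)" by (rule dual[OF y])
qed (rule structure_equations, use assms(2) in blast)

lemma eq_by_components:
  assumes "y \<in> V" "\<And>i. e i y X = e i y Y"
  shows "X = Y"
  using frame_expansion[OF assms(1), of X] frame_expansion[OF assms(1), of Y] assms(2) by simp

lemma horizontal_iff:
  assumes "y \<in> V"
  shows "X \<in> span {E 1 y, E 2 y, E 3 y, E 4 y} \<longleftrightarrow> e 5 y X = 0 \<and> e 6 y X = 0 \<and> e 7 y X = 0"
proof
  have sub: "subspace {X. e i y X = 0}" for i
    using linear_subspace_kernel[OF linear_e[OF assms]] .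
  have "span {E 1 y, E 2 y, E 3 y, E 4 y} \<subseteq> {X. e i y X = 0}" if "i \<in> {5, 6, 7}" for i
    using that by (intro span_minimal sub) (auto simp: dual[OF assms])
  then show "e 5 y X = 0 \<and> e 6 y X = 0 \<and> e 7 y X = 0" if "X \<in> span {E 1 y, E 2 y, E 3 y, E 4 y}"
    using that by blast
next
  assume *: "e 5 y X = 0 \<and> e 6 y X = 0 \<and> e 7 y X = 0"
  have "X = e 1 y X *\<^sub>R E 1 y + e 2 y X *\<^sub>R E 2 y + e 3 y X *\<^sub>R E 3 y + e 4 y X *\<^sub>R E 4 y"
    using frame_expansion[OF assms, of X] * by (simp add: sum_7)
  also have "\<dots> \<in> span {E 1 y, E 2 y, E 3 y, E 4 y}"
    by (intro span_add span_scale span_base) auto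
  finally show "X \<in> span {E 1 y, E 2 y, E 3 y, E 4 y}" .
qed

lemma vertical_brackets:
  assumes "y \<in> V"
  shows "lie_bracket (E 5) (E 6) y = (1/2) *\<^sub>R E 7 y" "lie_bracket (E 6) (E 5) y = (- 1/2) *\<^sub>R E 7 y"
    and "lie_bracket (E 5) (E 7) y = 0" "lie_bracket (E 7) (E 5) y = 0"
    and "lie_bracket (E 6) (E 7) y = 0" "lie_bracket (E 7) (E 6) y = 0"
    and "lie_bracket (E i) (E i) y = 0"
  by (simp_all add: lie_bracket_E[OF assms] sum_7 ext_deriv_e[OF assms] wedge_def dual[OF assms])

lemma dim_horizontal:
  assumes "y \<in> V"
  shows "dim (span {E 1 y, E 2 y, E 3 y, E 4 y}) = 4"
proof -
  have inj: "inj (\<lambda>i. E i y)"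
  proof (rule injI)
    fix i j assume "E i y = E j y"
    then have "e i y (E i y) = e i y (E j y)" by simp
    then show "i = j" by (simp add: dual[OF assms] split: if_splits)
  qed
  have "independent ((\<lambda>i. E i y) ` {1, 2, 3, 4})"
  proof (rule independent_if_scalars_zero)
    fix f x assume *: "(\<Sum>x\<in>(\<lambda>i. E i y) ` {1, 2, 3, 4}. f x *\<^sub>R x) = 0" "x \<in> (\<lambda>i. E i y) ` {1, 2, 3, 4}"
    then obtain k where k: "x = E k y" "k \<in> {1, 2, 3, 4}" by blast
    have "(\<Sum>i\<in>{1, 2, 3, 4}. f (E i y) *\<^sub>R E i y) = 0"
      using *(1) inj by (subst (asm) sum.reindex) (auto simp: inj_on_def inj_def)
    then have "e k y (\<Sum>i\<in>{1, 2, 3, 4}. f (E i y) *\<^sub>R E i y) = e k y 0" by (rule arg_cong)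
    then show "f x = 0"
      using k linear_e[OF assms, of k]
      by (auto simp: linear_add linear_cmul linear_0 dual[OF assms])
  qed simp
  moreover have "card ((\<lambda>i. E i y) ` {1, 2, 3, 4}) = 4"
    using inj by (subst card_image) (auto simp: inj_on_def inj_def)
  ultimately show ?thesis
    using dim_eq_card_independent[of "(\<lambda>i. E i y) ` {1, 2, 3, 4}"] by simp
qed

end

section \<open>Null planes and the integrability obstruction\<close>

context G1_coframe
begin

lemma D_has_derivative: "(u has_derivative u') (at y) \<Longrightarrow> D i u y = u' (E i y)"
  by (simp add: D_def frechet_derivative_at[symmetric])

lemma D_add:
  assumes "u differentiable at y" "v differentiable at y"
  shows "D i (\<lambda>z. u z + v z) y = D i u y + D i v y"
  using D_has_derivative[OF has_derivative_add[OF assms[unfolded frechet_derivative_works]]]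
  by (simp add: D_def)

lemma D_diff:
  assumes "u differentiable at y" "v differentiable at y"
  shows "D i (\<lambda>z. u z - v z) y = D i u y - D i v y"
  using D_has_derivative[OF has_derivative_diff[OF assms[unfolded frechet_derivative_works]]]
  by (simp add: D_def)

lemma D_mult:
  fixes u v :: "real^7 \<Rightarrow> complex"
  assumes "u differentiable at y" "v differentiable at y"
  shows "D i (\<lambda>z. u z * v z) y = u y * D i v y + D i u y * v y"
  using frechet_derivative_bilinear(2)[OF bounded_bilinear_mult assms] by (simp add: D_def)

lemma D_const: "D i (\<lambda>z. c) y = 0"
  by (simp add: D_def)

lemma D_cong: "open W \<Longrightarrow> y \<in> W \<Longrightarrow> u differentiable at y \<Longrightarrow> (\<And>z. z \<in> W \<Longrightarrow> u z = v z) \<Longrightarrow> D i u y = D i v y"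
  unfolding D_def using frechet_derivative_transform_within_open[of u y W v] by simp

text \<open>The fields \<open>Z\<^sub>1\<close> and \<open>Z\<^sub>2\<close> that span the null plane of slope \<open>\<mu>\<close>, as differential operators on
  complex functions.\<close>

definition Z1 :: "(real^7 \<Rightarrow> complex) \<Rightarrow> (real^7 \<Rightarrow> complex) \<Rightarrow> real^7 \<Rightarrow> complex" where
  "Z1 \<mu> u y = D 1 u y + \<i> * D 2 u y + \<mu> y * (D 3 u y + \<i> * D 4 u y)"

definition Z2 :: "(real^7 \<Rightarrow> complex) \<Rightarrow> (real^7 \<Rightarrow> complex) \<Rightarrow> real^7 \<Rightarrow> complex" where
  "Z2 \<mu> u y = D 3 u y - \<i> * D 4 u y - \<mu> y * (D 1 u y - \<i> * D 2 u y)"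

text \<open>The first two terms on the right come from differentiating the slope, the others from the brackets of the
  frame. No vertical derivative of \<open>u\<close> appears because \<open>\<omega>\<^sub>r(Z\<^sub>1, Z\<^sub>2) = 0\<close> for each \<open>r\<close>.\<close>

lemma Z_commutator:
  assumes W: "open W" "W \<subseteq> V" and sm: "smooth_on W \<mu>" "smooth_on W u" and y: "y \<in> W"
  shows "Z1 \<mu> (Z2 \<mu> u) y - Z2 \<mu> (Z1 \<mu> u) y =
    - Z1 \<mu> \<mu> y * (D 1 u y - \<i> * D 2 u y) - Z2 \<mu> \<mu> y * (D 3 u y + \<i> * D 4 u y)
    - 2 * \<i> * \<mu> y * D 2 u y - (1 + (\<mu> y)\<^sup>2) * D 3 u y + 2 * \<i> * ((\<mu> y)\<^sup>2 - 1) * D 4 u y"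
proof -
  note du = smooth_on_differentiable[OF smooth_on_D[OF W sm(2)] y]
  note dm = smooth_on_differentiable[OF sm(1) y]
  have cd: "(\<lambda>z. c) differentiable at y" for c :: complex by simp
  note d = du dm cd differentiable_add differentiable_diff differentiable_mult
  have D1: "D i (Z1 \<mu> u) y = D i (D 1 u) y + \<i> * D i (D 2 u) y
      + \<mu> y * (D i (D 3 u) y + \<i> * D i (D 4 u) y) + D i \<mu> y * (D 3 u y + \<i> * D 4 u y)" for i
    unfolding Z1_def by (simp only: D_add D_mult D_const d) (simp add: algebra_simps)
  have D2: "D i (Z2 \<mu> u) y = D i (D 3 u) y - \<i> * D i (D 4 u) y
      - \<mu> y * (D i (D 1 u) y - \<i> * D i (D 2 u) y) - D i \<mu> y * (D 1 u y - \<i> * D 2 u y)" for i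
    unfolding Z2_def by (simp only: D_diff D_mult D_const d) (simp add: algebra_simps)
  note c = D_commutator[OF W sm(2) y, unfolded scaleR_conv_of_real diff_eq_eq]
  have i: "\<i> * (\<i> * x) = - x" for x by (simp flip: mult.assoc)
  show ?thesis
    unfolding Z1_def[of \<mu> "Z2 \<mu> u"] Z2_def[of \<mu> "Z1 \<mu> u"] D1 D2 Z1_def[of \<mu> \<mu>] Z2_def[of \<mu> \<mu>] c
    by (simp add: algebra_simps power2_eq_square i)
qed

end

text \<open>The three hypotheses say that \<open>b\<close> is orthogonal to \<open>J\<^sub>1 a\<close>, \<open>J\<^sub>2 a\<close>, \<open>J\<^sub>3 a\<close> for the quaternionic units \<open>J\<^sub>r\<close>.
  As \<open>(a \<cdot> a) b = (a \<cdot> b) a + \<Sum>\<^sub>r (J\<^sub>r a \<cdot> b) J\<^sub>r a\<close> for all \<open>a\<close> and \<open>b\<close>, this leaves \<open>(a \<cdot> a) b = (a \<cdot> b) a\<close>, and both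
  coefficients vanish when \<open>a\<close> and \<open>b\<close> are independent.\<close>

lemma null_pair_isotropic:
  fixes a1 a2 a3 a4 b1 b2 b3 b4 :: complex
  assumes "a1 * b2 - a2 * b1 + (a3 * b4 - a4 * b3) = 0"
    and "a1 * b3 - a3 * b1 + (a4 * b2 - a2 * b4) = 0"
    and "a1 * b4 - a4 * b1 + (a2 * b3 - a3 * b2) = 0"
    and ne: "a1 * b3 - a3 * b1 \<noteq> 0"
  shows "a1 * a1 + a2 * a2 + a3 * a3 + a4 * a4 = 0"
    and "a1 * b1 + a2 * b2 + a3 * b3 + a4 * b4 = 0"
proof -
  let ?aa = "a1 * a1 + a2 * a2 + a3 * a3 + a4 * a4" and ?ab = "a1 * b1 + a2 * b2 + a3 * b3 + a4 * b4"
  have 1: "?aa * b1 = ?ab * a1" and 3: "?aa * b3 = ?ab * a3"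
    using assms(1-3) by algebra+
  have "?aa * (a1 * b3 - a3 * b1) = 0"
    using 1 3 by algebra
  then show aa: "?aa = 0" using ne by simp
  have "a1 \<noteq> 0 \<or> a3 \<noteq> 0" using ne by auto
  then show "?ab = 0" using 1 3 aa by auto
qed

context G1_coframe
begin

text \<open>The hypotheses make the common kernel in \<open>H \<otimes> \<complex>\<close> of \<open>dw\<^sub>1\<close> and \<open>dw\<^sub>2\<close> a null plane, which at \<open>p\<close> has slope \<open>0\<close>.
  Near \<open>p\<close> its slope is a smooth function \<open>\<mu>\<close>. Since \<open>Z\<^sub>1\<close> and \<open>Z\<^sub>2\<close> annihilate both functions, so
  does their commutator; this determines \<open>Z\<^sub>1 \<mu>\<close> and \<open>Z\<^sub>2 \<mu>\<close>, and these values violate the commutator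
  identity for \<open>\<mu>\<close> itself at \<open>p\<close>.\<close>

lemma null_coordinates_impossible:
  fixes w1 w2 :: "real^7 \<Rightarrow> complex"
  assumes sm: "smooth_on V w1" "smooth_on V w2" and p: "p \<in> V"
    and null: "\<And>y. y \<in> V \<Longrightarrow> D 1 w1 y * D 2 w2 y - D 2 w1 y * D 1 w2 y + (D 3 w1 y * D 4 w2 y - D 4 w1 y * D 3 w2 y) = 0"
      "\<And>y. y \<in> V \<Longrightarrow> D 1 w1 y * D 3 w2 y - D 3 w1 y * D 1 w2 y + (D 4 w1 y * D 2 w2 y - D 2 w1 y * D 4 w2 y) = 0"
      "\<And>y. y \<in> V \<Longrightarrow> D 1 w1 y * D 4 w2 y - D 4 w1 y * D 1 w2 y + (D 2 w1 y * D 3 w2 y - D 3 w1 y * D 2 w2 y) = 0"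
    and w1: "D 1 w1 p = 1" "D 2 w1 p = \<i>" "D 3 w1 p = 0" "D 4 w1 p = 0"
    and w2: "D 1 w2 p = 0" "D 2 w2 p = 0" "D 3 w2 p = 1" "D 4 w2 p = -\<i>"
  shows False
proof -
  \<comment> \<open>The slope solves \<open>Z\<^sub>2 w\<^sub>1 = 0\<close>, that is, \<open>P \<mu> = Q\<close>. The determinant \<open>\<Delta>\<close> expresses that \<open>dw\<^sub>1\<close>, \<open>dw\<^sub>2\<close> are
    independent on the complement \<open>span(e\<^sub>1 - i e\<^sub>2, e\<^sub>3 + i e\<^sub>4)\<close> of the null plane, and \<open>N\<close> is a minor that
    shows their independence on \<open>H\<close>. All three are nonzero at \<open>p\<close>, and \<open>W\<close> is the open set where they stay so.\<close>
  define P where "P y = D 1 w1 y - \<i> * D 2 w1 y" for y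
  define Q where "Q y = D 3 w1 y - \<i> * D 4 w1 y" for y
  define \<Delta> where "\<Delta> y = P y * (D 3 w2 y + \<i> * D 4 w2 y) - (D 3 w1 y + \<i> * D 4 w1 y) * (D 1 w2 y - \<i> * D 2 w2 y)" for y
  define N where "N y = D 1 w1 y * D 3 w2 y - D 3 w1 y * D 1 w2 y" for y
  define W where "W = {y \<in> V. P y * \<Delta> y * N y \<noteq> 0}"
  have smD: "smooth_on V (D i w1)" "smooth_on V (D i w2)" for i
    using smooth_on_D[OF open_V] sm by auto
  note cont = smooth_on_continuous_on[OF smD(1)] smooth_on_continuous_on[OF smD(2)]
  have "continuous_on V (\<lambda>y. P y * \<Delta> y * N y)"
    unfolding P_def \<Delta>_def N_def by (intro continuous_intros cont)
  then have "open (V \<inter> (\<lambda>y. P y * \<Delta> y * N y) -` (- {0}))"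
    by (rule continuous_open_preimage) (auto simp: open_V)
  then have W: "open W" "W \<subseteq> V"
    by (auto simp: W_def vimage_def Int_def)
  have "p \<in> W"
    by (simp add: W_def p P_def \<Delta>_def N_def w1 w2)
  have ne: "P y \<noteq> 0" "\<Delta> y \<noteq> 0" "N y \<noteq> 0" if "y \<in> W" for y
    using that by (auto simp: W_def)
  define \<mu> where "\<mu> y = Q y * inverse (P y)" for y
  have smP: "smooth_on W P" and smQ: "smooth_on W Q"
    unfolding P_def Q_def
    by (intro smooth_on_diff smooth_on_mult smooth_on_const smooth_on_subset[OF smD(1) W(2)] W)+
  have sm\<mu>: "smooth_on W \<mu>"
    unfolding \<mu>_def by (intro smooth_on_mult smooth_on_inverse smP smQ W ne)
  have smw: "smooth_on W w1" "smooth_on W w2"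
    using sm W(2) smooth_on_subset by blast+
  have Pmu: "P y * \<mu> y = Q y" if "y \<in> W" for y
    using ne(1)[OF that] by (simp add: \<mu>_def)
  have "\<mu> p = 0" by (simp add: \<mu>_def Q_def w1)
  have i2: "\<i> * \<i> = - 1" by simp
  have Z0: "Z1 \<mu> w1 y = 0" "Z2 \<mu> w1 y = 0" "Z1 \<mu> w2 y = 0" "Z2 \<mu> w2 y = 0" if y: "y \<in> W" for y
  proof -
    have "y \<in> V" using y W by blast
    note nl = null[OF this]
    note iso = null_pair_isotropic[OF nl ne(3)[OF y, unfolded N_def]]
    show "Z2 \<mu> w1 y = 0"
      using Pmu[OF y] by (simp add: Z2_def P_def Q_def algebra_simps)
    have "P y * Z1 \<mu> w1 y = 0"
      using Pmu[OF y] iso(1) i2 unfolding Z1_def P_def Q_def by algebra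
    moreover have "P y * Z1 \<mu> w2 y = 0"
      using Pmu[OF y] iso(2) nl(1) i2 unfolding Z1_def P_def Q_def by algebra
    moreover have "P y * Z2 \<mu> w2 y = 0"
      using Pmu[OF y] nl(2,3) i2 unfolding Z2_def P_def Q_def by algebra
    ultimately show "Z1 \<mu> w1 y = 0" "Z1 \<mu> w2 y = 0" "Z2 \<mu> w2 y = 0"
      using ne(1)[OF y] by auto
  qed
  have Dzero: "D i u y = 0" if "\<And>z. z \<in> W \<Longrightarrow> u z = 0" "y \<in> W" for i y and u :: "real^7 \<Rightarrow> complex"
    using D_cong[OF W(1) that(2), of "\<lambda>_. 0" u i] that(1) by (simp add: D_const)
  have slope: "Z1 \<mu> \<mu> y = 3/2 * \<mu> y * (1 - (\<mu> y)\<^sup>2)" "Z2 \<mu> \<mu> y = 3/2 * ((\<mu> y)\<^sup>2 - 1)" if y: "y \<in> W" for y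
  proof -
    \<comment> \<open>Modulo \<open>Z\<^sub>1\<close> and \<open>Z\<^sub>2\<close>, the bracket \<open>[Z\<^sub>1, Z\<^sub>2]\<close> is \<open>\<alpha> (e\<^sub>1 - i e\<^sub>2) + \<beta> (e\<^sub>3 + i e\<^sub>4)\<close>.\<close>
    define \<alpha> where "\<alpha> = 3/2 * \<mu> y * (1 - (\<mu> y)\<^sup>2) - Z1 \<mu> \<mu> y"
    define \<beta> where "\<beta> = 3/2 * ((\<mu> y)\<^sup>2 - 1) - Z2 \<mu> \<mu> y"
    have rel: "\<alpha> * (D 1 w y - \<i> * D 2 w y) + \<beta> * (D 3 w y + \<i> * D 4 w y) = 0"
      if sw: "smooth_on W w" and z: "\<And>z. z \<in> W \<Longrightarrow> Z1 \<mu> w z = 0" "\<And>z. z \<in> W \<Longrightarrow> Z2 \<mu> w z = 0" for w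
    proof -
      have "Z1 \<mu> (Z2 \<mu> w) y = 0" "Z2 \<mu> (Z1 \<mu> w) y = 0"
        unfolding Z1_def[of \<mu> "Z2 \<mu> w"] Z2_def[of \<mu> "Z1 \<mu> w"]
        using Dzero[of "Z2 \<mu> w", OF z(2) y] Dzero[of "Z1 \<mu> w", OF z(1) y] by simp_all
      note * = Z_commutator[OF W sm\<mu> sw y, unfolded this]
      show ?thesis
        using * z(1)[OF y, unfolded Z1_def] z(2)[OF y, unfolded Z2_def] i2
        unfolding \<alpha>_def \<beta>_def by algebra
    qed
    note r = rel[OF smw(1) Z0(1,2)] rel[OF smw(2) Z0(3,4)]
    have "\<alpha> * \<Delta> y = 0" "\<beta> * \<Delta> y = 0"
      using r unfolding \<Delta>_def P_def by algebra+
    then have "\<alpha> = 0" "\<beta> = 0" using ne(2)[OF y] by auto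
    then show "Z1 \<mu> \<mu> y = 3/2 * \<mu> y * (1 - (\<mu> y)\<^sup>2)" "Z2 \<mu> \<mu> y = 3/2 * ((\<mu> y)\<^sup>2 - 1)"
      by (simp_all add: \<alpha>_def \<beta>_def)
  qed
  have d\<mu>: "\<mu> differentiable at p" using smooth_on_differentiable[OF sm\<mu> \<open>p \<in> W\<close>] .
  \<comment> \<open>Both sides of the commutator identity for \<open>\<mu>\<close> at \<open>p\<close>, where \<open>\<mu> = 0\<close>: the left one is \<open>9/4\<close>, the right one \<open>-3/4\<close>.\<close>
  have cd: "(\<lambda>z. c) differentiable at p" for c :: complex by simp
  note dd = d\<mu> cd differentiable_add differentiable_diff differentiable_mult
  have "D i (Z1 \<mu> \<mu>) p = D i (\<lambda>z. 3/2 * \<mu> z * (1 - \<mu> z * \<mu> z)) p" for i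
    by (rule D_cong[OF W(1) \<open>p \<in> W\<close>, symmetric]) (simp_all add: slope dd power2_eq_square)
  also have "\<dots> i = 3/2 * D i \<mu> p" for i
    by (simp only: D_mult D_diff D_const dd \<open>\<mu> p = 0\<close>) simp
  finally have 1: "D i (Z1 \<mu> \<mu>) p = 3/2 * D i \<mu> p" for i .
  have "D i (Z2 \<mu> \<mu>) p = D i (\<lambda>z. 3/2 * (\<mu> z * \<mu> z - 1)) p" for i
    by (rule D_cong[OF W(1) \<open>p \<in> W\<close>, symmetric]) (simp_all add: slope dd power2_eq_square)
  also have "\<dots> i = 0" for i
    by (simp only: D_mult D_diff D_const dd \<open>\<mu> p = 0\<close>) simp
  finally have 2: "D i (Z2 \<mu> \<mu>) p = 0" for i .
  show False
    using Z_commutator[OF W sm\<mu> sm\<mu> \<open>p \<in> W\<close>] slope[OF \<open>p \<in> W\<close>] i2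
    unfolding Z1_def[of \<mu> "Z2 \<mu> \<mu>"] Z2_def[of \<mu> "Z1 \<mu> \<mu>"] 1 2
    unfolding Z1_def Z2_def \<open>\<mu> p = 0\<close>
    by (simp, algebra)
qed

end

section \<open>Contact maps to the Heisenberg group\<close>

definition skew_unit :: "4 \<Rightarrow> 4 \<Rightarrow> real^4^4" where
  "skew_unit a b = (\<chi> i j. if i = a \<and> j = b then 1 else if i = b \<and> j = a then - 1 else 0)"

text \<open>The matrices of \<open>\<omega>\<^sub>1, \<omega>\<^sub>2, \<omega>\<^sub>3\<close> in the frame \<open>e\<^sub>1,\<dots>,e\<^sub>4\<close>; up to sign, the quaternionic units.\<close>

definition quat_form :: "3 \<Rightarrow> real^4^4" where
  "quat_form = triple (skew_unit 1 2 + skew_unit 3 4) (skew_unit 1 3 + skew_unit 4 2)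
     (skew_unit 1 4 + skew_unit 2 3)"

lemma quat_form_entries [simp]:
  "quat_form 1 $ i $ j = (skew_unit 1 2 + skew_unit 3 4) $ i $ j"
  "quat_form 2 $ i $ j = (skew_unit 1 3 + skew_unit 4 2) $ i $ j"
  "quat_form 3 $ i $ j = (skew_unit 1 4 + skew_unit 2 3) $ i $ j"
  by (simp_all add: quat_form_def triple_def)

lemma quat_form_combination_square:
  fixes a :: "3 \<Rightarrow> real"
  defines "K \<equiv> \<Sum>s\<in>UNIV. a s *\<^sub>R quat_form s"
  shows "K ** K = (- (\<Sum>s\<in>UNIV. (a s)\<^sup>2)) *\<^sub>R mat 1"
proof -
  have "(K ** K) $ i $ j = ((- (\<Sum>s\<in>UNIV. (a s)\<^sup>2)) *\<^sub>R mat 1) $ i $ j" for i j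
    using exhaust_4[of i] exhaust_4[of j]
    by (elim disjE; hypsubst) (simp add: K_def matrix_matrix_mult_def sum_4 sum_3 skew_unit_def
      mat_def power2_eq_square)+
  then show ?thesis by (simp add: vec_eq_iff)
qed

lemma quat_form_square: "quat_form r ** quat_form r = - mat 1"
  using quat_form_combination_square[of "\<lambda>s. if s = r then 1 else 0"]
  by (simp add: if_distrib[of "\<lambda>x. x *\<^sub>R _"] if_distrib[of "\<lambda>x. x\<^sup>2"] cong: if_cong)

lemma matrix_mult_scaleR:
  fixes A :: "real^'n^'m" and B :: "real^'k^'n"
  shows "(c *\<^sub>R A) ** B = c *\<^sub>R (A ** B)" and "A ** (c *\<^sub>R B) = c *\<^sub>R (A ** B)"
  by (simp_all add: vec_eq_iff matrix_matrix_mult_def sum_distrib_left mult_ac)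

lemma matrix_mult_sum_scaleR:
  fixes A :: "'a \<Rightarrow> real^'n^'m" and B :: "real^'k^'n" and C :: "real^'m^'k"
  shows "(\<Sum>s\<in>S. c s *\<^sub>R A s) ** B = (\<Sum>s\<in>S. c s *\<^sub>R (A s ** B))"
    and "C ** (\<Sum>s\<in>S. c s *\<^sub>R A s) = (\<Sum>s\<in>S. c s *\<^sub>R (C ** A s))"
  by (induction S rule: infinite_finite_induct)
    (simp_all add: vec_eq_iff matrix_matrix_mult_def algebra_simps sum.distrib sum_distrib_left)

lemma orthogonal_matrix_rows:
  fixes Q :: "real^'n^'n"
  assumes "orthogonal_matrix Q"
  shows "(\<Sum>k\<in>UNIV. Q $ i $ k * Q $ j $ k) = (if i = j then 1 else 0)"
proof -
  have "(Q ** transpose Q) $ i $ j = mat 1 $ i $ j"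
    using assms by (simp add: orthogonal_matrix_def)
  then show ?thesis by (simp add: matrix_matrix_mult_def transpose_def mat_def)
qed

lemma orthogonal_matrix_cols:
  fixes Q :: "real^'n^'n"
  assumes "orthogonal_matrix Q"
  shows "(\<Sum>k\<in>UNIV. Q $ k $ i * Q $ k $ j) = (if i = j then 1 else 0)"
  using orthogonal_matrix_rows[of "transpose Q" i j] assms
  by (simp only: orthogonal_matrix_transpose) (simp add: transpose_def)

text \<open>Write \<open>K\<^sub>r = \<Sum>\<^sub>s \<Psi>\<^sub>r\<^sub>s J\<^sub>s\<close>, again a unit: \<open>K\<^sub>r\<^sup>2 = -1\<close>. From \<open>M\<^sup>T J\<^sub>r M = \<nu> K\<^sub>r\<close> one gets the left inverse
  \<open>- \<nu>\<^sup>-\<^sup>1 K\<^sub>r M\<^sup>T J\<^sub>r\<close> of \<open>M\<close>; as it is also a right inverse, \<open>M K\<^sub>r M\<^sup>T = \<nu> J\<^sub>r\<close>,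
  and the orthogonality of \<open>\<Psi>\<close> turns the \<open>K\<^sub>r\<close> back into the \<open>J\<^sub>s\<close>.\<close>

lemma quat_form_conformal_transpose:
  fixes M :: "real^4^4" and \<Psi> :: "real^3^3"
  assumes M: "\<And>r. transpose M ** quat_form r ** M = \<nu> *\<^sub>R (\<Sum>s\<in>UNIV. \<Psi> $ r $ s *\<^sub>R quat_form s)"
    and "\<nu> > 0" and orth: "orthogonal_matrix \<Psi>"
  obtains N where "N ** M = mat 1"
    and "\<And>s. M ** quat_form s ** transpose M = \<nu> *\<^sub>R (\<Sum>r\<in>UNIV. \<Psi> $ r $ s *\<^sub>R quat_form r)"
proof -
  define K where "K r = (\<Sum>s\<in>UNIV. \<Psi> $ r $ s *\<^sub>R quat_form s)" for r
  note rows = orthogonal_matrix_rows[OF orth] and cols = orthogonal_matrix_cols[OF orth]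
  have KK: "K r ** K r = - mat 1" for r
    unfolding K_def quat_form_combination_square using rows[of r r] by (simp add: power2_eq_square)
  define N where "N r = (- inverse \<nu>) *\<^sub>R (K r ** transpose M ** quat_form r)" for r
  have NM: "N r ** M = mat 1" for r
  proof -
    have "N r ** M = (- inverse \<nu>) *\<^sub>R (K r ** (transpose M ** quat_form r ** M))"
      by (simp only: N_def matrix_mult_scaleR matrix_mul_assoc)
    also have "\<dots> = mat 1"
      using \<open>\<nu> > 0\<close> KK by (simp add: M K_def[symmetric] matrix_mult_scaleR)
    finally show ?thesis .
  qed
  then have MN: "M ** N r = mat 1" for r
    using matrix_left_right_inverse by blast
  have MKM: "M ** K r ** transpose M = \<nu> *\<^sub>R quat_form r" for r
  proof -
    have "mat 1 ** quat_form r = (- inverse \<nu>) *\<^sub>R (M ** K r ** transpose M ** (quat_form r ** quat_form r))"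
      unfolding MN[of r, symmetric] N_def by (simp only: matrix_mult_scaleR matrix_mul_assoc)
    then show ?thesis
      using \<open>\<nu> > 0\<close> matrix_mult_scaleR(2)[of "M ** K r ** transpose M" "-1" "mat 1"]
      by (simp add: quat_form_square)
  qed
  have "M ** quat_form s ** transpose M = \<nu> *\<^sub>R (\<Sum>r\<in>UNIV. \<Psi> $ r $ s *\<^sub>R quat_form r)" for s
  proof -
    have "(\<Sum>r\<in>UNIV. \<Psi> $ r $ s *\<^sub>R K r) = (\<Sum>t\<in>UNIV. (\<Sum>r\<in>UNIV. \<Psi> $ r $ s * \<Psi> $ r $ t) *\<^sub>R quat_form t)"
      unfolding K_def by (simp add: scaleR_sum_right scaleR_sum_left, rule sum.swap)
    also have "\<dots> = quat_form s"
      by (simp add: cols if_distrib[of "\<lambda>x. x *\<^sub>R _"] cong: if_cong)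
    finally have "M ** quat_form s ** transpose M = (\<Sum>r\<in>UNIV. \<Psi> $ r $ s *\<^sub>R (M ** K r ** transpose M))"
      by (simp add: matrix_mult_sum_scaleR[symmetric])
    then show ?thesis
      by (simp add: MKM scaleR_sum_right mult.commute)
  qed
  with that NM show thesis by blast
qed

lemma linear_heis_contact: "linear (heis_contact r x)"
  using exhaust_3[of r]
  by (auto intro!: linearI simp: heis_contact_def triple_def heis_coframe_def algebra_simps)

lemma smooth_on_heis_contact:
  assumes "smooth_on S f" "smooth_on S g" "open S"
  shows "smooth_on S (\<lambda>x. heis_contact r (f x) (g x))"
proof -
  have "smooth_on S (\<lambda>x. heis_coframe k (f x) (g x))" if "k \<in> {5, 6, 7}" for k
    using that unfolding heis_coframe_def
    by (auto intro!: smooth_on_add smooth_on_diff smooth_on_mult smooth_on_component assms)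
  then show ?thesis
    using exhaust_3[of r] by (auto simp: heis_contact_def triple_def)
qed

lemma differentiable_heis_contact: "(\<lambda>x. heis_contact r x v) differentiable at x"
proof -
  have "smooth_on UNIV (\<lambda>x :: real^7. x)"
    unfolding smooth_on_def
  proof
    fix k show "times_differentiable_on k UNIV (\<lambda>x :: real^7. x)"
      by (cases k) (simp_all add: times_differentiable_on_const)
  qed
  then show ?thesis
    using smooth_on_differentiable[OF smooth_on_heis_contact[OF _ smooth_on_const[of UNIV v]], of "\<lambda>x. x" x r]
    by simp
qed

text \<open>Embeds the indices of the \<open>4 \<times> 4\<close> matrices into those of the coframe. The cases are spelled out because the
  last index is \<open>4 = 0\<close> in the type \<^typ>\<open>4\<close> but \<open>4 \<noteq> 0\<close> in the type \<^typ>\<open>7\<close>.\<close>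

definition horizontal_index :: "4 \<Rightarrow> 7" where
  "horizontal_index i = (if i = 1 then 1 else if i = 2 then 2 else if i = 3 then 3 else 4)"

lemma ext_deriv_heis_contact:
  "ext_deriv (heis_contact r) x u v =
    2 * (\<Sum>i\<in>UNIV. \<Sum>j\<in>UNIV. quat_form r $ i $ j * u $ horizontal_index i * v $ horizontal_index j)"
  using exhaust_3[of r] heis_structure_equations(2-4)[of x u v]
  by (auto simp: heis_contact_def triple_def wedge_def sum_4 skew_unit_def horizontal_index_def
      heis_coframe_def algebra_simps)

context G1_coframe
begin

lemma contact_lie_bracket:
  assumes "y \<in> V"
  shows "triple (e 5) (e 6) (e 7) s y (lie_bracket (E (horizontal_index i)) (E (horizontal_index j)) y)
    = - 2 * quat_form s $ i $ j"
  using exhaust_3[of s] exhaust_4[of i] exhaust_4[of j]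
  by (elim disjE) (simp_all add: triple_def e_lie_bracket[OF assms] ext_deriv_e[OF assms] wedge_def
      dual[OF assms] skew_unit_def horizontal_index_def)

lemma contact_horizontal:
  "y \<in> V \<Longrightarrow> triple (e 5) (e 6) (e 7) s y (E (horizontal_index i) y) = 0"
  using exhaust_3[of s] exhaust_4[of i] by (auto simp: triple_def dual horizontal_index_def)

definition horizontal_jacobian :: "(real^7 \<Rightarrow> real^7) \<Rightarrow> real^7 \<Rightarrow> real^4^4" where
  "horizontal_jacobian f y = (\<chi> k j. D (horizontal_index j) f y $ horizontal_index k)"

text \<open>The forms \<open>\<beta> = F\<^sup>*\<theta>\<^sup>4\<^sup>+\<^sup>r = \<nu> \<Sum>\<^sub>s \<Psi>\<^sub>r\<^sub>s \<eta>\<^sub>s\<close> vanish on horizontal fields, so \<open>d\<beta>(e\<^sub>i, e\<^sub>j) = - \<beta>([e\<^sub>i, e\<^sub>j])\<close>. The left side is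
  the pullback of \<open>d\<theta>\<^sup>4\<^sup>+\<^sup>r\<close>, and in the right side \<open>\<eta>\<^sub>s([e\<^sub>i, e\<^sub>j]) = - 2 \<omega>\<^sub>s(e\<^sub>i, e\<^sub>j)\<close>.\<close>

lemma horizontal_jacobian_conformal:
  assumes f: "smooth_on V f"
    and flat: "\<And>y r v. y \<in> V \<Longrightarrow> heis_contact r (f y) (frechet_derivative f (at y) v) =
      \<nu> y * (\<Sum>s\<in>UNIV. \<Psi> y $ r $ s * triple (e 5) (e 6) (e 7) s y v)"
    and y: "y \<in> V"
  shows "transpose (horizontal_jacobian f y) ** quat_form r ** horizontal_jacobian f y =
    \<nu> y *\<^sub>R (\<Sum>s\<in>UNIV. \<Psi> y $ r $ s *\<^sub>R quat_form s)"
proof -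
  define \<beta> where "\<beta> z v = heis_contact r (f z) (frechet_derivative f (at z) v)" for z v
  have lin: "linear (\<beta> z)" if "z \<in> V" for z
    unfolding \<beta>_def
    using linear_compose[OF linear_frechet_derivative_smooth_on[OF f that] linear_heis_contact[of r "f z"]]
    by (simp add: o_def)
  have sm: "smooth_on V (\<lambda>z. \<beta> z v)" for v
    unfolding \<beta>_def by (intro smooth_on_heis_contact smooth_on_frechet_derivative f open_V)
  have entry: "(\<Sum>a\<in>UNIV. \<Sum>b\<in>UNIV. quat_form r $ a $ b * horizontal_jacobian f y $ a $ i *
      horizontal_jacobian f y $ b $ j) = \<nu> y * (\<Sum>s\<in>UNIV. \<Psi> y $ r $ s * quat_form s $ i $ j)" for i j
  proof -
    let ?X = "E (horizontal_index i)" and ?Y = "E (horizontal_index j)"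
    have zero: "frechet_derivative (\<lambda>z. \<beta> z (E (horizontal_index i) z)) (at y) = (\<lambda>v. 0)" for i
    proof -
      have "((\<lambda>z. \<beta> z (E (horizontal_index i) z)) has_derivative (\<lambda>v. 0)) (at y)"
        by (rule has_derivative_transform_within_open[OF has_derivative_const open_V y])
          (simp add: \<beta>_def flat contact_horizontal)
      then show ?thesis by (simp add: frechet_derivative_at[symmetric])
    qed
    have "ext_deriv \<beta> y (?X y) (?Y y) = - \<beta> y (lie_bracket ?X ?Y y)"
      using ext_deriv_fields[where \<alpha>=\<beta> and X="?X" and Y="?Y", OF open_V y lin sm smooth_E smooth_E] by (simp add: zero)
    also have "\<dots> = 2 * (\<nu> y * (\<Sum>s\<in>UNIV. \<Psi> y $ r $ s * quat_form s $ i $ j))"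
      unfolding \<beta>_def flat[OF y] contact_lie_bracket[OF y]
      by (simp add: sum_distrib_left mult_ac sum_negf)
    finally have "ext_deriv (heis_contact r) (f y) (D (horizontal_index i) f y) (D (horizontal_index j) f y) =
        2 * (\<nu> y * (\<Sum>s\<in>UNIV. \<Psi> y $ r $ s * quat_form s $ i $ j))"
      unfolding \<beta>_def D_def
      by (subst (asm) ext_deriv_pullback[OF f open_V y linear_heis_contact differentiable_heis_contact])
    then show ?thesis
      by (simp add: ext_deriv_heis_contact horizontal_jacobian_def)
  qed
  have "(transpose M ** A ** M) $ i $ j = (\<Sum>a\<in>UNIV. \<Sum>b\<in>UNIV. A $ a $ b * M $ a $ i * M $ b $ j)"
    for M A :: "real^4^4" and i j
    by (simp add: matrix_matrix_mult_def transpose_def sum_4 algebra_simps)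
  then show ?thesis
    by (simp add: vec_eq_iff entry)
qed

lemma D_linear:
  fixes L :: "real^7 \<Rightarrow> complex"
  assumes "linear L" "f differentiable at y"
  shows "D i (\<lambda>x. L (f x)) y = L (D i f y)"
proof -
  have "bounded_linear L" using assms(1) linear_conv_bounded_linear by blast
  from D_has_derivative[OF bounded_linear.has_derivative[OF this assms(2)[unfolded frechet_derivative_works]]]
  show ?thesis by (simp add: D_def)
qed

text \<open>A linear change of the coordinates \<open>x\<^sup>1,\<dots>,x\<^sup>4\<close> by \<open>N = M(p)\<^sup>-\<^sup>1\<close> makes the horizontal Jacobian \<open>L = N M\<close> the identity at \<open>p\<close>.
  The transposed conformality relation says that \<open>M J\<^sub>s M\<^sup>T\<close> lies in the span of the \<open>J\<^sub>t\<close> at every point; used at \<open>p\<close> it shows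
  the same for \<open>N J\<^sub>s N\<^sup>T\<close>, and hence for \<open>L J\<^sub>s L\<^sup>T\<close> at every point. So the new coordinates \<open>h\<^sub>1,\<dots>,h\<^sub>4\<close> give
  functions \<open>h\<^sub>1 + i h\<^sub>2\<close> and \<open>h\<^sub>3 - i h\<^sub>4\<close> whose horizontal differentials are paired to \<open>0\<close> by each \<open>J\<^sub>s\<close>.\<close>

lemma no_flattening_map:
  assumes f: "smooth_on V f"
    and flat: "\<And>y r v. y \<in> V \<Longrightarrow> heis_contact r (f y) (frechet_derivative f (at y) v) =
      \<nu> y * (\<Sum>s\<in>UNIV. \<Psi> y $ r $ s * triple (e 5) (e 6) (e 7) s y v)"
    and pos: "\<And>y. y \<in> V \<Longrightarrow> 0 < \<nu> y" and orth: "\<And>y. y \<in> V \<Longrightarrow> orthogonal_matrix (\<Psi> y)"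
  shows "V = {}"
proof (rule ccontr)
  assume "V \<noteq> {}"
  then obtain p where p: "p \<in> V" by blast
  define M where "M = horizontal_jacobian f"
  have conf: "transpose (M y) ** quat_form r ** M y = \<nu> y *\<^sub>R (\<Sum>s\<in>UNIV. \<Psi> y $ r $ s *\<^sub>R quat_form s)"
    if "y \<in> V" for y r
    unfolding M_def by (rule horizontal_jacobian_conformal[OF f flat that])
  obtain N where N: "N ** M p = mat 1" and
    Mp: "\<And>s. M p ** quat_form s ** transpose (M p) = \<nu> p *\<^sub>R (\<Sum>r\<in>UNIV. \<Psi> p $ r $ s *\<^sub>R quat_form r)"
    using quat_form_conformal_transpose[OF conf[OF p] pos[OF p] orth[OF p]] by blast
  have NJN: "\<exists>c. N ** quat_form r ** transpose N = (\<Sum>s\<in>UNIV. c s *\<^sub>R quat_form s)" for r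
  proof -
    have tN: "transpose (M p) ** transpose N = mat 1"
      using N by (metis matrix_transpose_mul transpose_mat)
    have 1: "quat_form s = (\<Sum>t\<in>UNIV. (\<nu> p * \<Psi> p $ t $ s) *\<^sub>R (N ** quat_form t ** transpose N))" for s
    proof -
      have "quat_form s = N ** M p ** quat_form s ** (transpose (M p) ** transpose N)"
        by (simp add: N tN)
      also have "\<dots> = N ** (M p ** quat_form s ** transpose (M p)) ** transpose N"
        by (simp add: matrix_mul_assoc)
      also have "M p ** quat_form s ** transpose (M p) = (\<Sum>t\<in>UNIV. (\<nu> p * \<Psi> p $ t $ s) *\<^sub>R quat_form t)"
        by (simp add: Mp scaleR_sum_right)
      finally show ?thesis
        by (simp only: matrix_mult_sum_scaleR)
    qed
    have "(\<Sum>s\<in>UNIV. \<Psi> p $ r $ s *\<^sub>R quat_form s) = (\<Sum>s\<in>UNIV. \<Sum>t\<in>UNIV.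
        (\<nu> p * (\<Psi> p $ r $ s * \<Psi> p $ t $ s)) *\<^sub>R (N ** quat_form t ** transpose N))"
      by (subst 1) (simp add: scaleR_sum_right mult_ac)
    also have "\<dots> = (\<Sum>t\<in>UNIV. (\<nu> p * (\<Sum>s\<in>UNIV. \<Psi> p $ r $ s * \<Psi> p $ t $ s)) *\<^sub>R
        (N ** quat_form t ** transpose N))"
      by (subst sum.swap) (simp add: scaleR_sum_left sum_distrib_left)
    also have "\<dots> = \<nu> p *\<^sub>R (N ** quat_form r ** transpose N)"
      by (simp add: orthogonal_matrix_rows[OF orth[OF p]] if_distrib[of "\<lambda>x. _ * x"]
          if_distrib[of "\<lambda>x. x *\<^sub>R _"] cong: if_cong)
    finally have "N ** quat_form r ** transpose N =
        inverse (\<nu> p) *\<^sub>R (\<Sum>s\<in>UNIV. \<Psi> p $ r $ s *\<^sub>R quat_form s)"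
      using pos[OF p] by simp
    then have "N ** quat_form r ** transpose N =
        (\<Sum>s\<in>UNIV. (inverse (\<nu> p) * \<Psi> p $ r $ s) *\<^sub>R quat_form s)"
      by (simp only: scaleR_sum_right scaleR_scaleR)
    then show ?thesis by (rule exI[where x="\<lambda>s. inverse (\<nu> p) * \<Psi> p $ r $ s"])
  qed
  define L where "L y = N ** M y" for y
  have Lp: "L p = mat 1" by (simp add: L_def N)
  have LJL: "\<exists>c. L y ** quat_form s ** transpose (L y) = (\<Sum>t\<in>UNIV. c t *\<^sub>R quat_form t)" if y: "y \<in> V" for y s
  proof -
    obtain c where c: "\<And>r. N ** quat_form r ** transpose N = (\<Sum>t\<in>UNIV. c r t *\<^sub>R quat_form t)"
      using NJN by metis
    have My: "M y ** quat_form s ** transpose (M y) = (\<Sum>r\<in>UNIV. (\<nu> y * \<Psi> y $ r $ s) *\<^sub>R quat_form r)"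
      using quat_form_conformal_transpose[OF conf[OF y] pos[OF y] orth[OF y]]
      by (metis (mono_tags, lifting) scaleR_scaleR scaleR_sum_right sum.cong)
    have "L y ** quat_form s ** transpose (L y) = N ** (M y ** quat_form s ** transpose (M y)) ** transpose N"
      by (simp add: L_def matrix_transpose_mul matrix_mul_assoc)
    also have "\<dots> = (\<Sum>r\<in>UNIV. (\<nu> y * \<Psi> y $ r $ s) *\<^sub>R (\<Sum>t\<in>UNIV. c r t *\<^sub>R quat_form t))"
      by (simp only: My matrix_mult_sum_scaleR c)
    also have "\<dots> = (\<Sum>t\<in>UNIV. (\<Sum>r\<in>UNIV. \<nu> y * \<Psi> y $ r $ s * c r t) *\<^sub>R quat_form t)"
      by (simp add: scaleR_sum_right scaleR_sum_left, rule sum.swap)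
    finally show ?thesis by (rule exI[where x="\<lambda>t. \<Sum>r\<in>UNIV. \<nu> y * \<Psi> y $ r $ s * c r t"])
  qed
  define l1 where "l1 v = Complex (\<Sum>k\<in>UNIV. N $ 1 $ k * v $ horizontal_index k) (\<Sum>k\<in>UNIV. N $ 2 $ k * v $ horizontal_index k)" for v :: "real^7"
  define l2 where "l2 v = Complex (\<Sum>k\<in>UNIV. N $ 3 $ k * v $ horizontal_index k) (- (\<Sum>k\<in>UNIV. N $ 4 $ k * v $ horizontal_index k))" for v :: "real^7"
  have lin: "linear l1" "linear l2"
    unfolding l1_def l2_def
    by (auto intro!: linearI simp: complex_eq_iff sum.distrib sum_distrib_left algebra_simps)
  have Dw: "D (horizontal_index j) (\<lambda>x. l1 (f x)) y = Complex (L y $ 1 $ j) (L y $ 2 $ j)"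
    "D (horizontal_index j) (\<lambda>x. l2 (f x)) y = Complex (L y $ 3 $ j) (- L y $ 4 $ j)" if "y \<in> V" for j y
    unfolding D_linear[OF lin(1) smooth_on_differentiable[OF f that]]
      D_linear[OF lin(2) smooth_on_differentiable[OF f that]]
    unfolding l1_def l2_def L_def M_def
    by (simp_all add: matrix_matrix_mult_def horizontal_jacobian_def)
  note Dw' = Dw[of _ 1, unfolded horizontal_index_def, simplified] Dw[of _ 2, unfolded horizontal_index_def, simplified]
    Dw[of _ 3, unfolded horizontal_index_def, simplified] Dw[of _ 4, unfolded horizontal_index_def, simplified]
  \<comment> \<open>These two combinations of entries are the real and imaginary parts of the pairing of the two complex
    covectors (rows 1, 2 and rows 3, 4) under \<open>J\<^sub>s\<close>, and they vanish on each \<open>J\<^sub>t\<close>.\<close>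
  have null: "(L y ** quat_form s ** transpose (L y)) $ 1 $ 3 + (L y ** quat_form s ** transpose (L y)) $ 2 $ 4 = 0 \<and>
    (L y ** quat_form s ** transpose (L y)) $ 2 $ 3 - (L y ** quat_form s ** transpose (L y)) $ 1 $ 4 = 0"
    if y: "y \<in> V" for y s
  proof -
    obtain c where "L y ** quat_form s ** transpose (L y) = (\<Sum>t\<in>UNIV. c t *\<^sub>R quat_form t)"
      using LJL[OF y] by blast
    then show ?thesis by (simp add: sum_3 skew_unit_def triple_def)
  qed
  note null' = null[of _ 1] null[of _ 2] null[of _ 3]
  note null'' = null'[unfolded matrix_matrix_mult_def transpose_def, simplified,
      unfolded sum_4 skew_unit_def triple_def, simplified]
  show False
  proof (rule null_coordinates_impossible[OF _ _ p])
    show "smooth_on V (\<lambda>x. l1 (f x))" "smooth_on V (\<lambda>x. l2 (f x))"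
      by (rule smooth_on_linear[OF lin(1) f open_V], rule smooth_on_linear[OF lin(2) f open_V])
  next
    fix y assume y: "y \<in> V"
    let ?w1 = "\<lambda>x. l1 (f x)" and ?w2 = "\<lambda>x. l2 (f x)"
    show "D 1 ?w1 y * D 2 ?w2 y - D 2 ?w1 y * D 1 ?w2 y + (D 3 ?w1 y * D 4 ?w2 y - D 4 ?w1 y * D 3 ?w2 y) = 0"
      using null''(1)[OF y] by (simp add: Dw'[OF y] complex_eq_iff algebra_simps)
    show "D 1 ?w1 y * D 3 ?w2 y - D 3 ?w1 y * D 1 ?w2 y + (D 4 ?w1 y * D 2 ?w2 y - D 2 ?w1 y * D 4 ?w2 y) = 0"
      using null''(2)[OF y] by (simp add: Dw'[OF y] complex_eq_iff algebra_simps)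
    show "D 1 ?w1 y * D 4 ?w2 y - D 4 ?w1 y * D 1 ?w2 y + (D 2 ?w1 y * D 3 ?w2 y - D 3 ?w1 y * D 2 ?w2 y) = 0"
      using null''(3)[OF y] by (simp add: Dw'[OF y] complex_eq_iff algebra_simps)
  qed (simp_all add: Dw'[OF p] Lp mat_def complex_eq_iff)
qed

end

section \<open>The quaternionic contact structure\<close>

text \<open>The frame on the manifold. In each chart it is an instance of \<open>G1_coframe\<close>, through which the local
  results apply.\<close>

locale G1_charts =
  fixes A :: "('m::{t2_space,second_countable_topology}, real^7) chart set"
    and e :: "7 \<Rightarrow> ('m, real^7) form1"
    and E :: "7 \<Rightarrow> ('m, real^7) vfield"
  assumes atlas: "smooth_atlas A"
    and form: "smooth_form A (e i)"
    and field: "smooth_vector_field A (E i)"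
    and dual: "\<forall>c\<in>A. \<forall>y\<in>chart_range c. \<forall>i j. e i c y (E j c y) = (if i = j then 1 else 0)"
    and structure_equations: "G1_structure_equations A e"
begin

lemma chart_coframe:
  assumes "c \<in> A"
  shows "G1_coframe (chart_range c) (\<lambda>i. e i c) (\<lambda>i. E i c)"
proof (rule G1_coframe.intro)
  fix y i j u v
  show "open (chart_range c)"
    using atlas assms unfolding smooth_atlas_def by blast
  show "smooth_on (chart_range c) (\<lambda>y. e i c y v)"
    using form[of i] assms unfolding smooth_form_def by blast
  show "smooth_on (chart_range c) (E i c)"
    using field[of i] assms unfolding smooth_vector_field_def by blast
  assume y: "y \<in> chart_range c"
  show "linear (e i c y)"
    using form[of i] assms y unfolding smooth_form_def by blast
  show "e i c y (E j c y) = (if i = j then 1 else 0)"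
    using dual assms y by blast
qed (rule structure_equations[unfolded G1_structure_equations_def, rule_format, OF assms])

lemma G1_contact_chart: "G1_contact e r c = triple (e 5 c) (e 6 c) (e 7 c) r"
  by (simp add: G1_contact_def triple_def)

lemma not_qc_conformally_flat: "\<not> locally_qc_conformally_flat A (G1_contact e)"
proof
  assume flat: "locally_qc_conformally_flat A (G1_contact e)"
  fix p :: 'm
  obtain c where c: "c \<in> A" "p \<in> chart_dom c"
    using atlas unfolding smooth_atlas_def by blast
  obtain U and F :: "'m \<Rightarrow> real^7" and \<nu> :: "'m \<Rightarrow> real" and \<Psi> :: "'m \<Rightarrow> real^3^3"
    where U: "open U" "p \<in> U" and F: "smooth_map A euclidean_atlas U F" and \<nu>: "\<forall>x\<in>U. 0 < \<nu> x"
      and \<Psi>: "\<forall>x\<in>U. rotation_matrix (\<Psi> x)"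
      and eq: "\<forall>c\<in>A. \<forall>x\<in>U \<inter> chart_dom c. \<forall>r v.
          heis_contact r (F x) (differential c (UNIV, id) F (coord c x) v) =
             \<nu> x * (\<Sum>s\<in>UNIV. \<Psi> x $ r $ s * G1_contact e s c (coord c x) v)"
    using flat[unfolded locally_qc_conformally_flat_def, rule_format, of p]
    by (elim exE conjE) (rule that; assumption)
  have hom: "homeomorphism (chart_dom c) (chart_range c) (coord c) (chart_inv c)"
    and op: "open (chart_dom c)" "open (chart_range c)"
    using atlas c(1) unfolding smooth_atlas_def by blast+
  interpret G1_coframe "chart_range c" "\<lambda>i. e i c" "\<lambda>i. E i c"
    by (rule chart_coframe[OF c(1)])
  define W where "W = coord c ` (U \<inter> chart_dom c)"
  define f where "f y = F (chart_inv c y)" for y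
  have inv: "chart_inv c (coord c x) = x" if "x \<in> chart_dom c" for x
    using hom that by (simp add: homeomorphism_def)
  have "openin (top_of_set (chart_range c)) W"
    unfolding W_def
    by (rule homeomorphism_imp_open_map[OF hom]) (use U(1) in \<open>auto simp: openin_open\<close>)
  then have W: "open W" "W \<subseteq> chart_range c"
    using op(2) openin_open_trans by (auto simp: W_def chart_range_def)
  have smooth: "smooth_on W f"
  proof -
    let ?d = "(UNIV, id) :: (real^7, real^7) chart"
    have "smooth_on (coord c ` {x \<in> U \<inter> chart_dom c. F x \<in> chart_dom ?d})
        (\<lambda>y. coord ?d (F (chart_inv c y)))"
      using F c(1) unfolding smooth_map_def euclidean_atlas_def by blast
    moreover have "{x \<in> U \<inter> chart_dom c. F x \<in> chart_dom ?d} = U \<inter> chart_dom c"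
      by auto
    ultimately show ?thesis by (simp add: W_def f_def[abs_def])
  qed
  interpret W: G1_coframe W "\<lambda>i. e i c" "\<lambda>i. E i c"
    by (rule G1_coframe_subset[OF W])
  have "W = {}"
  proof (rule W.no_flattening_map[OF smooth])
    fix y r v assume "y \<in> W"
    then obtain x where x: "x \<in> U \<inter> chart_dom c" "y = coord c x" by (auto simp: W_def)
    show "heis_contact r (f y) (frechet_derivative f (at y) v) = \<nu> (chart_inv c y) *
        (\<Sum>s\<in>UNIV. \<Psi> (chart_inv c y) $ r $ s * triple (e 5 c) (e 6 c) (e 7 c) s y v)"
      using eq[rule_format, OF c(1) x(1), of r v] x inv
      by (simp add: differential_def G1_contact_chart f_def[abs_def])
  next
    fix y assume "y \<in> W"
    then have "chart_inv c y \<in> U" using inv by (auto simp: W_def)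
    then show "0 < \<nu> (chart_inv c y)" "orthogonal_matrix (\<Psi> (chart_inv c y))"
      using \<nu> \<Psi> by (auto simp: rotation_matrix_def)
  qed
  then show False using U c by (auto simp: W_def)
qed

lemma G1_horizontal_iff:
  assumes "c \<in> A" "y \<in> chart_range c"
  shows "X \<in> G1_horizontal E c y \<longleftrightarrow> e 5 c y X = 0 \<and> e 6 c y X = 0 \<and> e 7 c y X = 0"
proof -
  interpret G1_coframe "chart_range c" "\<lambda>i. e i c" "\<lambda>i. E i c"
    by (rule chart_coframe[OF assms(1)])
  show ?thesis using horizontal_iff[OF assms(2)] by (simp add: G1_horizontal_def)
qed

text \<open>The only nonzero bracket among \<open>e\<^sub>5, e\<^sub>6, e\<^sub>7\<close> is \<open>[e\<^sub>5, e\<^sub>6] = 1/2 e\<^sub>7\<close>. The mixed Reeb condition holds because \<open>e\<^sup>4 \<and> e\<^sup>6\<close>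
  in \<open>de\<^sup>5\<close> and \<open>e\<^sup>4 \<and> e\<^sup>5\<close> in \<open>de\<^sup>6\<close> have opposite signs.\<close>

lemma qc_integrable: "qc_integrable A (G1_horizontal E) (G1_contact e)"
proof -
  define \<xi> where "\<xi> = triple (E 5) (E 6) (E 7)"
  have "reeb_fields A (G1_horizontal E) (G1_contact e) \<xi>"
    unfolding reeb_fields_def
  proof (intro conjI allI ballI)
    fix r show "smooth_vector_field A (\<xi> r)"
      using field by (simp add: \<xi>_def triple_def)
  next
    fix c y r s assume cy: "c \<in> A" "y \<in> chart_range c"
    interpret G1_coframe "chart_range c" "\<lambda>i. e i c" "\<lambda>i. E i c"
      by (rule chart_coframe[OF cy(1)])
    show "G1_contact e r c y (\<xi> s c y) = (if r = s then 1 else 0)"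
      using exhaust_3[of r] exhaust_3[of s]
      by (elim disjE; hypsubst) (simp_all add: G1_contact_def \<xi>_def triple_def dual[OF cy(2)])
    fix X assume X: "X \<in> G1_horizontal E c y"
    note X = X[unfolded G1_horizontal_iff[OF cy]]
    show "ext_deriv (G1_contact e r c) y (\<xi> r c y) X = 0"
      using exhaust_3[of r]
      by (elim disjE; hypsubst) (simp_all add: X G1_contact_def \<xi>_def triple_def dual[OF cy(2)] ext_deriv_e[OF cy(2)] wedge_def)
    show "ext_deriv (G1_contact e s c) y (\<xi> r c y) X = - ext_deriv (G1_contact e r c) y (\<xi> s c y) X"
      using exhaust_3[of r] exhaust_3[of s]
      by (elim disjE; hypsubst) (simp_all add: X G1_contact_def \<xi>_def triple_def dual[OF cy(2)] ext_deriv_e[OF cy(2)] wedge_def)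
  qed
  moreover have "lie_bracket (\<xi> r c) (\<xi> s c) y \<in> span (range (\<lambda>t. \<xi> t c y))"
    if cy: "c \<in> A" "y \<in> chart_range c" for c y r s
  proof -
    interpret G1_coframe "chart_range c" "\<lambda>i. e i c" "\<lambda>i. E i c"
      by (rule chart_coframe[OF cy(1)])
    have "lie_bracket (\<xi> r c) (\<xi> s c) y \<in> {0, (1/2) *\<^sub>R \<xi> 3 c y, (- 1/2) *\<^sub>R \<xi> 3 c y}"
      using exhaust_3[of r] exhaust_3[of s]
      by (elim disjE; hypsubst) (simp_all add: \<xi>_def triple_def vertical_brackets[OF cy(2)])
    moreover have "a *\<^sub>R \<xi> 3 c y \<in> span (range (\<lambda>t. \<xi> t c y))" for a
      by (intro span_scale span_base rangeI)
    ultimately show ?thesis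
      by (metis insertE emptyE span_zero)
  qed
  ultimately show ?thesis
    unfolding qc_integrable_def by blast
qed

text \<open>On horizontal vectors \<open>de\<^sup>4\<^sup>+\<^sup>r\<close> reduces to \<open>2 \<omega>\<^sub>r\<close>. The compatibility of \<open>I\<^sub>r\<close> with the metric determines the
  components of \<open>I\<^sub>r X\<close> as signed permutations of those of \<open>X\<close>, and all algebraic conditions, the smoothness and the
  chart independence are then checked componentwise.\<close>

lemma qc_structure:
  assumes omega: "\<forall>c\<in>A. \<forall>y\<in>chart_range c. \<forall>r. \<forall>X\<in>G1_horizontal E c y.
           I r c y X \<in> G1_horizontal E c y \<and>
           (\<forall>Y\<in>G1_horizontal E c y. G1_metric e c y (I r c y X) Y = G1_omega e r c y X Y)"
  shows "qc_structure A (G1_horizontal E) (G1_metric e) I (G1_contact e)"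
proof -
  have I_components:
    "e 1 c y (I 1 c y X) = - e 2 c y X" "e 2 c y (I 1 c y X) = e 1 c y X"
    "e 3 c y (I 1 c y X) = - e 4 c y X" "e 4 c y (I 1 c y X) = e 3 c y X"
    "e 1 c y (I 2 c y X) = - e 3 c y X" "e 2 c y (I 2 c y X) = e 4 c y X"
    "e 3 c y (I 2 c y X) = e 1 c y X" "e 4 c y (I 2 c y X) = - e 2 c y X"
    "e 1 c y (I 3 c y X) = - e 4 c y X" "e 2 c y (I 3 c y X) = - e 3 c y X"
    "e 3 c y (I 3 c y X) = e 2 c y X" "e 4 c y (I 3 c y X) = e 1 c y X"
    "e 5 c y (I r c y X) = 0" "e 6 c y (I r c y X) = 0" "e 7 c y (I r c y X) = 0"
    and I_horizontal: "I r c y X \<in> G1_horizontal E c y"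
    if cy: "c \<in> A" "y \<in> chart_range c" and X: "X \<in> G1_horizontal E c y" for c y r X
  proof -
    interpret G1_coframe "chart_range c" "\<lambda>i. e i c" "\<lambda>i. E i c"
      by (rule chart_coframe[OF cy(1)])
    have EH: "E i c y \<in> G1_horizontal E c y" if "i \<in> {1, 2, 3, 4}" for i
      using that by (auto simp: G1_horizontal_iff[OF cy] dual[OF cy(2)])
    have "e i c y (I r c y X) = G1_omega e r c y X (E i c y)" if "i \<in> {1, 2, 3, 4}" for i r
    proof -
      have "G1_metric e c y (I r c y X) (E i c y) = G1_omega e r c y X (E i c y)"
        using omega cy X EH[OF that] by blast
      then show ?thesis using that by (auto simp: G1_metric_def dual[OF cy(2)])
    qed
    then show "e 1 c y (I 1 c y X) = - e 2 c y X" "e 2 c y (I 1 c y X) = e 1 c y X"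
    "e 3 c y (I 1 c y X) = - e 4 c y X" "e 4 c y (I 1 c y X) = e 3 c y X"
    "e 1 c y (I 2 c y X) = - e 3 c y X" "e 2 c y (I 2 c y X) = e 4 c y X"
    "e 3 c y (I 2 c y X) = e 1 c y X" "e 4 c y (I 2 c y X) = - e 2 c y X"
    "e 1 c y (I 3 c y X) = - e 4 c y X" "e 2 c y (I 3 c y X) = - e 3 c y X"
    "e 3 c y (I 3 c y X) = e 2 c y X" "e 4 c y (I 3 c y X) = e 1 c y X"
      by (simp_all add: G1_omega_def triple_def wedge_def dual[OF cy(2)])
    show "I r c y X \<in> G1_horizontal E c y" using omega cy X by blast
    then show "e 5 c y (I r c y X) = 0" "e 6 c y (I r c y X) = 0" "e 7 c y (I r c y X) = 0"
      by (simp_all add: G1_horizontal_iff[OF cy])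
  qed
  have pointwise: "G1_horizontal E c y = {X. \<forall>r. G1_contact e r c y X = 0}"
    "dim (G1_horizontal E c y) = 4"
    "\<And>X Y. G1_metric e c y X Y = G1_metric e c y Y X"
    "\<And>X Y Z a b. G1_metric e c y (a *\<^sub>R X + b *\<^sub>R Y) Z = a * G1_metric e c y X Z + b * G1_metric e c y Y Z"
    "\<And>X. X \<in> G1_horizontal E c y \<Longrightarrow> X \<noteq> 0 \<Longrightarrow> 0 < G1_metric e c y X X"
    "\<And>r X. X \<in> G1_horizontal E c y \<Longrightarrow> I r c y (I r c y X) = - X"
    "\<And>r X Y a b. X \<in> G1_horizontal E c y \<Longrightarrow> Y \<in> G1_horizontal E c y \<Longrightarrow>
       I r c y (a *\<^sub>R X + b *\<^sub>R Y) = a *\<^sub>R I r c y X + b *\<^sub>R I r c y Y"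
    "\<And>r X Y. X \<in> G1_horizontal E c y \<Longrightarrow> Y \<in> G1_horizontal E c y \<Longrightarrow>
       G1_metric e c y (I r c y X) (I r c y Y) = G1_metric e c y X Y"
    "\<And>X. X \<in> G1_horizontal E c y \<Longrightarrow> I 1 c y (I 2 c y X) = I 3 c y X"
    "\<And>X. X \<in> G1_horizontal E c y \<Longrightarrow> I 2 c y (I 1 c y X) = - I 3 c y X"
    "\<And>r X Y. X \<in> G1_horizontal E c y \<Longrightarrow> Y \<in> G1_horizontal E c y \<Longrightarrow>
       2 * G1_metric e c y (I r c y X) Y = ext_deriv (G1_contact e r c) y X Y"
    if cy: "c \<in> A" "y \<in> chart_range c" for c y
  proof -
    interpret G1_coframe "chart_range c" "\<lambda>i. e i c" "\<lambda>i. E i c"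
      by (rule chart_coframe[OF cy(1)])
    note lin = linear_e[OF cy(2)]
    note lins = linear_add[OF lin] linear_cmul[OF lin] linear_neg[OF lin] linear_0[OF lin]
    note comps = I_components[OF cy] I_horizontal[OF cy]
    have eqI: "X = Y" if "e 1 c y X = e 1 c y Y \<and> e 2 c y X = e 2 c y Y \<and> e 3 c y X = e 3 c y Y \<and>
      e 4 c y X = e 4 c y Y \<and> e 5 c y X = e 5 c y Y \<and> e 6 c y X = e 6 c y Y \<and> e 7 c y X = e 7 c y Y" for X Y
      using that eq_by_components[OF cy(2)] forall_7[of "\<lambda>i. e i c y X = e i c y Y"] by blast
    show "G1_horizontal E c y = {X. \<forall>r. G1_contact e r c y X = 0}"
      by (auto simp: G1_horizontal_iff[OF cy] forall_3 G1_contact_def triple_def)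
    show "dim (G1_horizontal E c y) = 4"
      unfolding G1_horizontal_def by (rule dim_horizontal[OF cy(2)])
    show "G1_metric e c y X Y = G1_metric e c y Y X" for X Y
      by (simp add: G1_metric_def mult.commute)
    show "G1_metric e c y (a *\<^sub>R X + b *\<^sub>R Y) Z = a * G1_metric e c y X Z + b * G1_metric e c y Y Z" for X Y Z a b
      by (simp add: G1_metric_def lins algebra_simps)
    show "0 < G1_metric e c y X X" if X: "X \<in> G1_horizontal E c y" "X \<noteq> 0" for X
    proof (rule ccontr)
      assume "\<not> 0 < G1_metric e c y X X"
      then have "G1_metric e c y X X = 0"
        by (simp add: G1_metric_def not_less) (smt (verit) zero_le_square)
      then have "e i c y X = 0" if "i \<in> {1, 2, 3, 4}" for i
        using that unfolding G1_metric_def by (subst (asm) sum_nonneg_eq_0_iff) auto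
      then have "X = 0" using X(1) by (intro eqI) (simp add: lins G1_horizontal_iff[OF cy])
      with X(2) show False by simp
    qed
    show "I r c y (I r c y X) = - X" if X: "X \<in> G1_horizontal E c y" for r X
      using exhaust_3[of r] X by (intro eqI) (auto simp: comps lins G1_horizontal_iff[OF cy])
    show "I r c y (a *\<^sub>R X + b *\<^sub>R Y) = a *\<^sub>R I r c y X + b *\<^sub>R I r c y Y"
      if X: "X \<in> G1_horizontal E c y" and Y: "Y \<in> G1_horizontal E c y" for r X Y a b
    proof -
      have XY: "a *\<^sub>R X + b *\<^sub>R Y \<in> G1_horizontal E c y"
        using X Y by (simp add: G1_horizontal_iff[OF cy] lins)
      show ?thesis
        using exhaust_3[of r] by (intro eqI) (auto simp: comps XY X Y lins)
    qed
    show "G1_metric e c y (I r c y X) (I r c y Y) = G1_metric e c y X Y"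
      if X: "X \<in> G1_horizontal E c y" and Y: "Y \<in> G1_horizontal E c y" for r X Y
      using exhaust_3[of r] by (auto simp: G1_metric_def comps X Y)
    show "I 1 c y (I 2 c y X) = I 3 c y X" "I 2 c y (I 1 c y X) = - I 3 c y X"
      if X: "X \<in> G1_horizontal E c y" for X
      by (intro eqI, simp add: comps X lins)+
    show "2 * G1_metric e c y (I r c y X) Y = ext_deriv (G1_contact e r c) y X Y"
      if X: "X \<in> G1_horizontal E c y" and Y: "Y \<in> G1_horizontal E c y" for r X Y
      using exhaust_3[of r] X Y
      by (auto simp: G1_metric_def comps G1_contact_def triple_def ext_deriv_e[OF cy(2)] wedge_def
          G1_horizontal_iff[OF cy])
  qed
  have smooth: "smooth_on W Y \<Longrightarrow> smooth_on W (\<lambda>y. G1_metric e c y (X y) (Y y))"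
      "smooth_on W (\<lambda>y. I r c y (X y))"
    if c: "c \<in> A" and H: "\<forall>y\<in>W. X y \<in> G1_horizontal E c y \<and> Y y \<in> G1_horizontal E c y"
      and W: "open W" "W \<subseteq> chart_range c" and X: "smooth_on W X" for c W X Y r
  proof -
    interpret G1_coframe "chart_range c" "\<lambda>i. e i c" "\<lambda>i. E i c"
      by (rule chart_coframe[OF c])
    interpret W: G1_coframe W "\<lambda>i. e i c" "\<lambda>i. E i c"
      by (rule G1_coframe_subset[OF W])
    have s: "smooth_on W (\<lambda>y. e i c y (X y))" if "smooth_on W X" for i X
      by (rule smooth_on_contraction[where \<alpha>="e i c", OF W(1) W.linear_e W.smooth_e that])
    show "smooth_on W (\<lambda>y. G1_metric e c y (X y) (Y y))" if "smooth_on W Y"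
      unfolding G1_metric_def by (intro smooth_on_sum smooth_on_mult s X that W(1))
    show "smooth_on W (\<lambda>y. I r c y (X y))"
    proof -
      have comp: "smooth_on W (\<lambda>y. e i c y (I r c y (X y)))" for i
      proof -
        have neg: "smooth_on W (\<lambda>y. - e i c y (X y))" for i
          by (intro smooth_on_uminus s X W(1))
        have cong: "smooth_on W f" if "smooth_on W g" "\<And>y. y \<in> W \<Longrightarrow> f y = g y" for f g :: "_ \<Rightarrow> real"
          using smooth_on_cong[of W f g, OF W(1) that(2)] that(1) by blast
        have cH: "y \<in> chart_range c" "X y \<in> G1_horizontal E c y" if "y \<in> W" for y
          using W(2) H that by auto
        note k = cong[OF s[OF X]] cong[OF neg] cong[OF smooth_on_const[of W 0]]
        show ?thesis
          using exhaust_3[of r] exhaust_7[of i]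
          by (elim disjE; hypsubst) (rule k, rule I_components[OF c cH], assumption+)+
      qed
      let ?S = "\<lambda>y. \<Sum>i\<in>UNIV. e i c y (I r c y (X y)) *\<^sub>R E i c y"
      have "smooth_on W ?S"
        by (intro smooth_on_sum smooth_on_scaleR comp W.smooth_E W(1))
      moreover have "I r c y (X y) = ?S y" if "y \<in> W" for y
        by (rule W.frame_expansion[OF that])
      ultimately show ?thesis
        using smooth_on_cong[of W "\<lambda>y. I r c y (X y)" ?S, OF W(1)] by blast
    qed
  qed
  have change: "G1_metric e d (coord d x) (differential c d id (coord c x) X) (differential c d id (coord c x) Y) =
        G1_metric e c (coord c x) X Y"
      "I r d (coord d x) (differential c d id (coord c x) X) =
        differential c d id (coord c x) (I r c (coord c x) X)"
    if cd: "c \<in> A" "d \<in> A" and x: "x \<in> chart_dom c \<inter> chart_dom d"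
      and X: "X \<in> G1_horizontal E c (coord c x)" for c d x X Y r
  proof -
    define y z T where yz: "y = coord c x" "z = coord d x" and T: "T = differential c d id y"
    note X = X[folded yz]
    have y: "y \<in> chart_range c" and z: "z \<in> chart_range d"
      using x yz by (auto simp: chart_range_def)
    interpret d: G1_coframe "chart_range d" "\<lambda>i. e i d" "\<lambda>i. E i d"
      by (rule chart_coframe[OF cd(2)])
    have eT: "e i d z (T v) = e i c y v" for i v
    proof -
      have "preserves_form A id (e i)" using form unfolding smooth_form_def by blast
      from this[unfolded preserves_form_def, rule_format, OF cd, of x v]
      show ?thesis using x yz T by simp
    qed
    have TX: "T X \<in> G1_horizontal E d z"
      using X by (simp add: G1_horizontal_iff[OF cd(1) y] G1_horizontal_iff[OF cd(2) z] eT)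
    have "I r d z (T X) = T (I r c y X)"
    proof (rule d.eq_by_components[OF z])
      fix i show "e i d z (I r d z (T X)) = e i d z (T (I r c y X))"
        using exhaust_3[of r] exhaust_7[of i]
        by (elim disjE) (simp_all add: eT I_components[OF cd(1) y X] I_components[OF cd(2) z TX])
    qed
    moreover have "G1_metric e d z (T X) (T Y) = G1_metric e c y X Y"
      by (simp add: G1_metric_def eT)
    ultimately show "G1_metric e d (coord d x) (differential c d id (coord c x) X)
        (differential c d id (coord c x) Y) = G1_metric e c (coord c x) X Y"
      "I r d (coord d x) (differential c d id (coord c x) X) =
        differential c d id (coord c x) (I r c (coord c x) X)"
      by (simp_all add: yz T)
  qed
  have contact: "smooth_form A (G1_contact e r)" for r
    using form by (simp add: G1_contact_def triple_def)
  show ?thesis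
    unfolding qc_structure_def Let_def
    by (intro conjI ballI allI impI; (elim conjE)?)
      (rule atlas contact pointwise I_horizontal smooth change, assumption+ | rule atlas contact pointwise)+
qed

end

theorem proposition4p4:
  fixes A :: "('m::{t2_space,second_countable_topology}, real^7) chart set"
    and G :: "'m monoid"
    and e :: "7 \<Rightarrow> ('m, real^7) form1"
    and E :: "7 \<Rightarrow> ('m, real^7) vfield"
    and I :: "3 \<Rightarrow> ('m, real^7) chart \<Rightarrow> real^7 \<Rightarrow> real^7 \<Rightarrow> real^7"
  assumes "lie_group A G" and "simply_connected (UNIV :: 'm set)" and "solvable G"
    and "\<forall>i. left_invariant_form A G (e i)"
    and "\<forall>i. left_invariant_vector_field A G (E i)"
    and dual: "\<forall>c\<in>A. \<forall>y\<in>chart_range c. \<forall>i j. e i c y (E j c y) = (if i = j then 1 else 0)"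
    and "G1_structure_equations A e"
    and omega: "\<forall>c\<in>A. \<forall>y\<in>chart_range c. \<forall>r. \<forall>X\<in>G1_horizontal E c y.
           I r c y X \<in> G1_horizontal E c y \<and>
           (\<forall>Y\<in>G1_horizontal E c y. G1_metric e c y (I r c y X) Y = G1_omega e r c y X Y)"
  shows "qc_structure A (G1_horizontal E) (G1_metric e) I (G1_contact e)
         \<and> qc_integrable A (G1_horizontal E) (G1_contact e)
         \<and> \<not> locally_qc_conformally_flat A (G1_contact e)"
proof -
  interpret G1_charts A e E
    using assms(1,4,5,7) dual
    by unfold_locales (auto simp: lie_group_def left_invariant_form_def left_invariant_vector_field_def)
  show ?thesis
    using qc_structure[OF omega] qc_integrable not_qc_conformally_flat by blast
qed

end
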